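(* Let $(\varepsilon,\beta)\in(0,1)\times(0,2]$, $\eta\in(0,1-\varepsilon)$, $(X_t)_{t\in[0,T]}\subseteq L_\eta$, $$\rho\in L(\varepsilon),\qquad X\in\mathcal L(\beta),\qquad \alpha:=\frac{1-(\varepsilon+\eta)}{\beta}.$$ If $\|X_s\|_{\mathrm{TV}(\rho,\eta)}<\infty$ for all $s\in(0,T]$ and $f\in\mathrm{LBV}^\eta_{\mathrm{loc}}(\mathbb R)\cap\mathrm{H\ddot ol}_\eta(\mathbb R)$, then (1) $\varphi(f,\rho)$ is an $L_\infty$-martingale of maximal oscillation, (2) $\displaystyle\inf_{t\in(0,T)}(T-t)^\alpha\,\underline{\mathrm{Osc}}_t(\varphi(f,\rho))>0$.
   Context: $T\in(0,\infty)$; $X=(X_t)_{t\in[0,T]}$ is a real Lévy process ($X_0\equiv0$, stationary independent increments, càdlàg paths) without Brownian part and with Lévy measure $\nu$ satisfying $\nu(\mathbb R)\in(0,\infty]$, on a complete probability space $(\Omega,\mathcal F,\mathbb P)$; $(\mathcal F_t)_{t\in[0,T]}$ is its augmented natural filtration, $\mathcal F=\mathcal F_T$. $\rho$ is a probability measure on $(\mathbb R,\mathcal B(\mathbb R))$ with $\rho(\{0\})=0$. $\rho\in L(\varepsilon)$ means $\liminf_{d\downarrow0}d^{-\varepsilon}\rho([-d,d])>0$. $X\in\mathcal L(\beta)$ means that there is an $r>0$ with $\inf_{-r\le a<b\le r}\inf_{s\in(0,T]}\mathbb P(s^{-1/\beta}X_s\in(a,b))/(b-a)>0$. For $\eta\in[0,1]$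 and $s\in[0,T]$, $\|X_s\|_{\mathrm{TV}(\rho,\eta)}:=\inf_P\int_{\mathbb R\setminus\{0\}}P(z)^{1-\eta}\rho(dz)\in[0,\infty]$, the infimum being over all measurable $P:\mathbb R\setminus\{0\}\to[0,\infty)$ with $\|\mathbb P_{z+X_s}-\mathbb P_{X_s}\|_{\mathrm{TV}}/|z|\le P(z)$ for $z\ne0$; $\mathbb P_\xi$ is the law of $\xi$ and $\|\mu\|_{\mathrm{TV}}=|\mu|(\mathbb R)$. $\mathrm{H\ddot ol}_\eta(\mathbb R)$ is the set of Borel $f:\mathbb R\to\mathbb R$ with $|f|_\eta:=\sup_{x<y}|f(x)-f(y)|/|x-y|^\eta<\infty$. $\mathrm{LBV}^\eta_{\mathrm{loc}}(\mathbb R)$ is the set of non-decreasing right-continuous $f:\mathbb R\to\mathbb R$ whose associated Borel measure $\mu_f$ ($\mu_f((a,b])=f(b)-f(a)$) satisfies $\liminf_{d\downarrow0}d^{-\eta}\mu_f([-d,d])>0$. $F(t,x):=\mathbb Ef(x+X_{T-t})$ and $D_\rho F(t,x):=\int_{\mathbb R\setminus\{0\}}\frac{F(t,x+z)-F(t,x)}{z}\,\rho(dz)$ for $(t,x)\in[0,T)\times\mathbb R$ (well defined under the hypotheses). $\varphi(f,\rho)$ is a càdlàg version of the martingale $(D_\rho F(t,X_t))_{t\in[0,T)}$. An $L_\infty$-martingale is a martingale $\varphi$ with $\varphi_t\in L_\infty$ for all $t\in[0,T)$. For a process $\varphi=(\varphi_t)_{t\in[0,T)}$ and $t\in(0,T)$,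 $\underline{\mathrm{Osc}}_t(\varphi):=\inf_{s\in[0,t)}\|\varphi_t-\varphi_s\|_{L_\infty}$; $\varphi$ is of maximal oscillation if there is a $c\ge1$ with $\underline{\mathrm{Osc}}_t(\varphi)\ge\frac1c\|\varphi_t-\varphi_0\|_{L_\infty}$ for all $t\in(0,T)$. *)

theory Defs
  imports "HOL-Probability.Probability"
begin

text \<open>
  Processes with index set \<open>[0,T]\<close> or \<open>[0,T)\<close> are functions \<open>real \<Rightarrow> 'a \<Rightarrow> real\<close>;
  their values outside the index set are never used.
\<close>

definition cadlag_on :: "real set \<Rightarrow> (real \<Rightarrow> real) \<Rightarrow> bool" where
  "cadlag_on I g \<longleftrightarrow> (\<forall>t\<in>I.
     (g \<longlongrightarrow> g t) (at t within I \<inter> {t<..}) \<and>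
     (\<exists>l. (g \<longlongrightarrow> l) (at t within I \<inter> {..<t})))"

definition levy_process :: "'a measure \<Rightarrow> real \<Rightarrow> (real \<Rightarrow> 'a \<Rightarrow> real) \<Rightarrow> bool" where
  "levy_process M T X \<longleftrightarrow>
     (\<forall>t\<in>{0..T}. X t \<in> borel_measurable M) \<and>
     (\<forall>\<omega>\<in>space M. X 0 \<omega> = 0) \<and>
     (\<forall>s t. 0 \<le> s \<and> s \<le> t \<and> t \<le> T \<longrightarrow>
        distr M borel (\<lambda>\<omega>. X t \<omega> - X s \<omega>) = distr M borel (X (t - s))) \<and>
     (\<forall>(n::nat) t. 0 \<le> t 0 \<and> (\<forall>i<n. t i < t (Suc i)) \<and> t n \<le> T \<longrightarrow>
        prob_space.indep_vars M (\<lambda>_. borel) (\<lambda>i \<omega>. X (t (Suc i)) \<omega> - X (t i) \<omega>) {..<n}) \<and>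
     (\<forall>\<omega>\<in>space M. cadlag_on {0..T} (\<lambda>t. X t \<omega>))"

definition levy_measure :: "real measure \<Rightarrow> bool" where
  "levy_measure \<nu> \<longleftrightarrow> sets \<nu> = sets borel \<and> emeasure \<nu> {0} = 0 \<and>
     (\<integral>\<^sup>+x. ennreal (min 1 (x\<^sup>2)) \<partial>\<nu>) < \<infinity>"

text \<open>
  The characteristic triplet \<open>(\<gamma>, \<sigma>, \<nu>)\<close> is fixed by the Levy-Khintchine formula with the
  truncation function \<open>x \<mapsto> x 1\<^bsub>{|x| \<le> 1}\<^esub>\<close>; another truncation only changes \<open>\<gamma>\<close>.
  There is no Brownian part iff \<open>\<sigma> = 0\<close>.
\<close>

definition levy_triplet ::
    "'a measure \<Rightarrow> real \<Rightarrow> (real \<Rightarrow> 'a \<Rightarrow> real) \<Rightarrow> real \<Rightarrow> real \<Rightarrow> real measure \<Rightarrow> bool" where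
  "levy_triplet M T X \<gamma> \<sigma> \<nu> \<longleftrightarrow> levy_measure \<nu> \<and>
     (\<forall>t\<in>{0..T}. \<forall>u. char (distr M borel (X t)) u =
        exp (of_real t * (\<i> * of_real (\<gamma> * u) - of_real (\<sigma>\<^sup>2 * u\<^sup>2 / 2) +
          (CLINT x|\<nu>. iexp (u * x) - 1 - \<i> * of_real (u * x * indicator {-1..1} x)))))"

definition augmented_filtration ::
    "'a measure \<Rightarrow> (real \<Rightarrow> 'a \<Rightarrow> real) \<Rightarrow> real \<Rightarrow> 'a measure" where
  "augmented_filtration M X t =
     sigma (space M) ({X s -` B \<inter> space M | s B. s \<in> {0..t} \<and> B \<in> sets borel} \<union> null_sets M)"

definition Linf_norm :: "'a measure \<Rightarrow> ('a \<Rightarrow> real) \<Rightarrow> ennreal" where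
  "Linf_norm M g = esssup M (\<lambda>\<omega>. ennreal \<bar>g \<omega>\<bar>)"

definition martingale_upto ::
    "'a measure \<Rightarrow> (real \<Rightarrow> 'a measure) \<Rightarrow> real \<Rightarrow> (real \<Rightarrow> 'a \<Rightarrow> real) \<Rightarrow> bool" where
  "martingale_upto M \<F> T \<phi> \<longleftrightarrow>
     (\<forall>t\<in>{0..<T}. \<phi> t \<in> borel_measurable (\<F> t) \<and> integrable M (\<phi> t)) \<and>
     (\<forall>s t. 0 \<le> s \<and> s \<le> t \<and> t < T \<longrightarrow>
        (AE \<omega> in M. real_cond_exp M (\<F> s) (\<phi> t) \<omega> = \<phi> s \<omega>))"

definition Linf_martingale_upto ::
    "'a measure \<Rightarrow> (real \<Rightarrow> 'a measure) \<Rightarrow> real \<Rightarrow> (real \<Rightarrow> 'a \<Rightarrow> real) \<Rightarrow> bool" where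
  "Linf_martingale_upto M \<F> T \<phi> \<longleftrightarrow>
     martingale_upto M \<F> T \<phi> \<and> (\<forall>t\<in>{0..<T}. Linf_norm M (\<phi> t) < \<infinity>)"

definition lower_Osc :: "'a measure \<Rightarrow> (real \<Rightarrow> 'a \<Rightarrow> real) \<Rightarrow> real \<Rightarrow> ennreal" where
  "lower_Osc M \<phi> t = (INF s\<in>{0..<t}. Linf_norm M (\<lambda>\<omega>. \<phi> t \<omega> - \<phi> s \<omega>))"

definition maximal_oscillation :: "'a measure \<Rightarrow> real \<Rightarrow> (real \<Rightarrow> 'a \<Rightarrow> real) \<Rightarrow> bool" where
  "maximal_oscillation M T \<phi> \<longleftrightarrow> (\<exists>c\<ge>1. \<forall>t\<in>{0<..<T}.
     lower_Osc M \<phi> t \<ge> ennreal (1 / c) * Linf_norm M (\<lambda>\<omega>. \<phi> t \<omega> - \<phi> 0 \<omega>))"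

definition lower_mass :: "real \<Rightarrow> real measure \<Rightarrow> bool" where
  "lower_mass \<epsilon> \<mu> \<longleftrightarrow>
     Liminf (at_right 0) (\<lambda>d. ennreal (d powr (- \<epsilon>)) * emeasure \<mu> {-d..d}) > 0"

definition lower_density ::
    "'a measure \<Rightarrow> real \<Rightarrow> real \<Rightarrow> (real \<Rightarrow> 'a \<Rightarrow> real) \<Rightarrow> bool" where
  "lower_density M T \<beta> X \<longleftrightarrow> (\<exists>r>0.
     (INF (a, b)\<in>{(a, b). - r \<le> a \<and> a < b \<and> b \<le> r}. INF s\<in>{0<..T}.
        ennreal (measure M {\<omega> \<in> space M. s powr (- 1 / \<beta>) * X s \<omega> \<in> {a<..<b}} / (b - a))) > 0)"

text \<open>The total variation \<open>|\<mu> - \<mu>'|(\<real>)\<close> of the signed measure \<open>\<mu> - \<mu>'\<close>.\<close>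

definition TV_dist :: "real measure \<Rightarrow> real measure \<Rightarrow> ennreal" where
  "TV_dist \<mu> \<mu>' =
     (SUP A\<in>{A :: nat \<Rightarrow> real set. range A \<subseteq> sets borel \<and> disjoint_family A \<and> (\<Union>i. A i) = UNIV}.
        \<Sum>i. ennreal \<bar>measure \<mu> (A i) - measure \<mu>' (A i)\<bar>)"

text \<open>
  \<open>TV_rho M \<rho> \<eta> Y\<close> is \<open>\<parallel>Y\<parallel>\<close> in \<open>TV(\<rho>, \<eta>)\<close>. As \<open>0 powr 0 = 0\<close>, the case \<open>\<eta> = 1\<close>,
  where the integrand is the constant 1, is treated separately.
\<close>

definition TV_rho :: "'a measure \<Rightarrow> real measure \<Rightarrow> real \<Rightarrow> ('a \<Rightarrow> real) \<Rightarrow> ennreal" where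
  "TV_rho M \<rho> \<eta> Y =
     (INF P\<in>{P \<in> borel_measurable (restrict_space borel (- {0})).
             \<forall>z. z \<noteq> 0 \<longrightarrow> 0 \<le> P z \<and>
               TV_dist (distr M borel (\<lambda>\<omega>. z + Y \<omega>)) (distr M borel Y) / ennreal \<bar>z\<bar> \<le> ennreal (P z)}.
        \<integral>\<^sup>+z\<in>- {0}. ennreal (if \<eta> = 1 then 1 else P z powr (1 - \<eta>)) \<partial>\<rho>)"

definition Hoelder :: "real \<Rightarrow> (real \<Rightarrow> real) set" where
  "Hoelder \<eta> = {f \<in> borel_measurable borel.
     (SUP (x, y)\<in>{(x, y). x < y}. ennreal (\<bar>f x - f y\<bar> / \<bar>x - y\<bar> powr \<eta>)) < \<infinity>}"

definition LBV_loc :: "real \<Rightarrow> (real \<Rightarrow> real) set" where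
  "LBV_loc \<eta> = {f. mono f \<and> (\<forall>x. continuous (at_right x) f) \<and> lower_mass \<eta> (interval_measure f)}"

definition F_fun ::
    "'a measure \<Rightarrow> real \<Rightarrow> (real \<Rightarrow> 'a \<Rightarrow> real) \<Rightarrow> (real \<Rightarrow> real) \<Rightarrow> real \<Rightarrow> real \<Rightarrow> real" where
  "F_fun M T X f t x = (LINT \<omega>|M. f (x + X (T - t) \<omega>))"

definition D_rho :: "real measure \<Rightarrow> (real \<Rightarrow> real \<Rightarrow> real) \<Rightarrow> real \<Rightarrow> real \<Rightarrow> real" where
  "D_rho \<rho> F t x = (LINT z:- {0}|\<rho>. (F t (x + z) - F t x) / z)"

definition cadlag_version_upto ::
    "'a measure \<Rightarrow> real \<Rightarrow> (real \<Rightarrow> 'a \<Rightarrow> real) \<Rightarrow> (real \<Rightarrow> 'a \<Rightarrow> real) \<Rightarrow> bool" where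
  "cadlag_version_upto M T \<phi> \<psi> \<longleftrightarrow>
     (\<forall>\<omega>\<in>space M. cadlag_on {0..<T} (\<lambda>t. \<phi> t \<omega>)) \<and>
     (\<forall>t\<in>{0..<T}. AE \<omega> in M. \<phi> t \<omega> = \<psi> t \<omega>)"

end

theory Submission
  imports Defs
begin

text \<open>
  Write \<open>G\<^sub>t = D\<^sub>\<rho> F(t, \<cdot>)\<close>. Interpolating between the Hoelder condition on \<open>f\<close> and the total
  variation bound dominates \<open>(F(t, x + z) - F(t, x)) / z\<close> by a \<open>\<rho>\<close>-integrable function of \<open>z\<close>, so
  \<open>G\<^sub>t\<close> is bounded and continuous, and the Markov property makes \<open>G\<^sub>t(X\<^sub>t)\<close> a martingale.
  As \<open>f\<close> is non-decreasing and grows sublinearly, \<open>G\<^sub>t \<ge> 0\<close> and \<open>inf G\<^sub>t = 0\<close>. The lower density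
  condition forces \<open>X\<^sub>u\<close> to have full support for every \<open>u > 0\<close>, hence
  \<open>\<parallel>\<phi>\<^sub>t - \<phi>\<^sub>s\<parallel> \<ge> \<bar>G\<^sub>t(y) - G\<^sub>s(0)\<bar>\<close> for all \<open>y\<close>, and therefore \<open>\<parallel>\<phi>\<^sub>t - \<phi>\<^sub>s\<parallel> \<ge> (sup G\<^sub>t) / 2\<close>. This
  yields maximal oscillation with \<open>c = 2\<close>; the rate comes from \<open>G\<^sub>t(0) \<ge> C (T - t)\<^bsup>-\<alpha>\<^esup>\<close>, where
  the three lower mass conditions are used at the scale \<open>(T - t)\<^bsup>1/\<beta>\<^esup>\<close>.
\<close>

subsection \<open>Interpolation between Hoelder and total variation bounds\<close>

text \<open>The density condition sees \<open>X s\<close> only in a window of size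
  \<open>s powr (1 / \<beta>)\<close>, whereas comparing oscillations requires \<open>X t\<close>
  near an arbitrary \<open>y\<close>, in particular near the remote points where \<open>G t\<close>
  is almost 0. Full support closes this gap. Mass near 0 alone would not suffice, as subordinators
  show: their small values are charged but they never leave a half-line. What excludes this is that
  both signs carry mass bounded below uniformly in time. The factor 2 is lost only once. If
  \<open>k\<close> bounds the oscillation between \<open>s\<close> and \<open>t\<close>, then
  \<open>G s 0\<close> lies within \<open>k\<close> of values of \<open>G t\<close> that are almost
  0, so \<open>G s 0 \<le> k\<close> and \<open>G t y \<le> 2 * k\<close>. Comparing with time 0
  costs nothing more, because \<open>G 0 0\<close> is an average of \<open>G t\<close> and both lie
  between 0 and the supremum of \<open>G t\<close>.\<close>

lemma Hoelder_const:
  assumes "f \<in> Hoelder \<eta>"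
  obtains H where "H > 0" "\<And>x y. \<bar>f x - f y\<bar> \<le> H * \<bar>x - y\<bar> powr \<eta>"
proof -
  define S where "S = (SUP (x, y)\<in>{(x, y). x < y}. ennreal (\<bar>f x - f y\<bar> / \<bar>x - y\<bar> powr \<eta>))"
  have "S < \<infinity>" using assms by (simp add: Hoelder_def S_def)
  then obtain c where c: "S = ennreal c" "c \<ge> 0" by (cases S) auto
  have lt: "\<bar>f x - f y\<bar> \<le> c * \<bar>x - y\<bar> powr \<eta>" if "x < y" for x y
  proof -
    have "ennreal (\<bar>f x - f y\<bar> / \<bar>x - y\<bar> powr \<eta>) \<le> S"
      unfolding S_def using that by (intro SUP_upper2[of "(x, y)"]) auto
    then have "\<bar>f x - f y\<bar> / \<bar>x - y\<bar> powr \<eta> \<le> c" using c by simp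
    moreover have "\<bar>x - y\<bar> powr \<eta> > 0" using that by simp
    ultimately show ?thesis by (simp add: pos_divide_le_eq)
  qed
  show ?thesis
  \<comment> \<open>Adding 1 keeps the constant positive when \<open>f\<close> is constant and
    \<open>c = 0\<close>.\<close>
  proof (rule that[of "c + 1"])
    show "c + 1 > 0" using c by simp
    fix x y
    have "\<bar>f x - f y\<bar> \<le> c * \<bar>x - y\<bar> powr \<eta>"
      using lt[of x y] lt[of y x] c by (cases x y rule: linorder_cases) (auto simp: abs_minus_commute)
    then show "\<bar>f x - f y\<bar> \<le> (c + 1) * \<bar>x - y\<bar> powr \<eta>"
      by (rule order_trans) (simp add: mult_right_mono)
  qed
qed

lemma Hoelder_isCont:
  fixes f :: "real \<Rightarrow> real"
  assumes "\<And>x y. \<bar>f x - f y\<bar> \<le> H * \<bar>x - y\<bar> powr \<eta>" "0 < \<eta>"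
  shows "isCont f x"
proof -
  have "((\<lambda>y. H * \<bar>y - x\<bar> powr \<eta>) \<longlongrightarrow> H * \<bar>x - x\<bar> powr \<eta>) (at x)"
    by (intro tendsto_mult tendsto_const tendsto_powr' tendsto_rabs tendsto_diff tendsto_ident_at)
       (use assms in auto)
  then have "((\<lambda>y. H * \<bar>y - x\<bar> powr \<eta>) \<longlongrightarrow> 0) (at x)"
    using assms(2) by simp
  then have "((\<lambda>y. f y - f x) \<longlongrightarrow> 0) (at x)"
    by (rule Lim_null_comparison[rotated]) (use assms in auto)
  then show ?thesis unfolding isCont_def using LIM_zero_cancel by blast
qed

text \<open>The Lipschitz part is the inf-convolution of \<open>f\<close> with \<open>L \<bar>\<cdot>\<bar>\<close>, \<open>L = H h\<^bsup>\<eta>-1\<^esup>\<close>.\<close>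

lemma Hoelder_split:
  fixes f :: "real \<Rightarrow> real"
  assumes f: "\<And>x y. \<bar>f x - f y\<bar> \<le> H * \<bar>x - y\<bar> powr \<eta>"
    and "0 < \<eta>" "\<eta> < 1" "0 < h" "0 < H"
  obtains g where "\<And>x y. \<bar>g x - g y\<bar> \<le> H * h powr (\<eta> - 1) * \<bar>x - y\<bar>"
    "\<And>x. 0 \<le> f x - g x" "\<And>x. f x - g x \<le> H * h powr \<eta>"
proof -
  define L where "L = H * h powr (\<eta> - 1)"
  have L: "L > 0" using assms by (simp add: L_def)
  \<comment> \<open>This bound serves twice: it makes the infimum finite, and it is the estimate of
    \<open>f - g\<close>. Up to distance \<open>h\<close> the constant term absorbs the Hoelder
    bound; beyond \<open>h\<close> the linear term does, since \<eta> - 1 < 0.\<close>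
  have key: "f x - H * h powr \<eta> \<le> f y + L * \<bar>x - y\<bar>" for x y
  proof -
    have "H * \<bar>x - y\<bar> powr \<eta> \<le> H * h powr \<eta> + L * \<bar>x - y\<bar>"
    proof (cases "\<bar>x - y\<bar> \<le> h")
      case True
      then have "H * \<bar>x - y\<bar> powr \<eta> \<le> H * h powr \<eta>"
        using assms by (intro mult_left_mono powr_mono2) auto
      then show ?thesis using L by (smt (verit) mult_nonneg_nonneg)
    next
      case False
      then have pos: "\<bar>x - y\<bar> > 0" using assms by auto
      have "\<bar>x - y\<bar> powr \<eta> = \<bar>x - y\<bar> powr (\<eta> - 1) * \<bar>x - y\<bar>"
        using pos by (simp add: powr_mult_base' flip: powr_add) (simp add: powr_diff)
      also have "\<dots> \<le> h powr (\<eta> - 1) * \<bar>x - y\<bar>"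
        using False assms by (intro mult_right_mono powr_mono2') auto
      finally have "H * \<bar>x - y\<bar> powr \<eta> \<le> L * \<bar>x - y\<bar>"
        using assms by (simp add: L_def mult.assoc)
      then show ?thesis using assms by (smt (verit) mult_nonneg_nonneg powr_ge_zero)
    qed
    then show ?thesis using f[of x y] by linarith
  qed
  define g where "g x = (INF y. f y + L * \<bar>x - y\<bar>)" for x
  have bdd: "bdd_below (range (\<lambda>y. f y + L * \<bar>x - y\<bar>))" for x
    using key[of x] by (intro bdd_belowI[of _ "f x - H * h powr \<eta>"]) auto
  have le: "g x \<le> f y + L * \<bar>x - y\<bar>" for x y
    unfolding g_def by (rule cINF_lower[OF bdd]) auto
  have lip: "g x \<le> g y + L * \<bar>x - y\<bar>" for x y
  proof -
    have "g x - L * \<bar>x - y\<bar> \<le> g y"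
      unfolding g_def[of y]
    proof (rule cINF_greatest)
      fix w
      have "L * \<bar>x - w\<bar> \<le> L * (\<bar>x - y\<bar> + \<bar>y - w\<bar>)"
        using L by (intro mult_left_mono) auto
      then show "g x - L * \<bar>x - y\<bar> \<le> f w + L * \<bar>y - w\<bar>"
        using le[of x w] by (simp add: distrib_left)
    qed simp
    then show ?thesis by simp
  qed
  show ?thesis
  proof (rule that[of g])
    show "\<bar>g x - g y\<bar> \<le> H * h powr (\<eta> - 1) * \<bar>x - y\<bar>" for x y
      using lip[of x y] lip[of y x] by (simp add: L_def abs_minus_commute abs_le_iff)
    show "0 \<le> f x - g x" for x using le[of x x] by simp
    show "f x - g x \<le> H * h powr \<eta>" for x
    proof -
      have "f x - H * h powr \<eta> \<le> g x"
        unfolding g_def using key by (intro cINF_greatest) auto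
      then show ?thesis by simp
    qed
  qed
qed

section \<open>Comparing expectations through total variation\<close>

lemma layer_cake:
  fixes g :: "'a \<Rightarrow> real"
  assumes "sigma_finite_measure M" and [measurable]: "g \<in> borel_measurable M"
    and g: "\<And>x. 0 \<le> g x"
  shows "(\<integral>\<^sup>+x. ennreal (g x) \<partial>M) =
    (\<integral>\<^sup>+u. indicator {0..} u * emeasure M {x \<in> space M. u < g x} \<partial>lborel)"
proof -
  interpret sigma_finite_measure M by fact
  interpret pair_sigma_finite M lborel ..
  have "(\<integral>\<^sup>+x. ennreal (g x) \<partial>M) = (\<integral>\<^sup>+x. \<integral>\<^sup>+u. indicator {0..<g x} u \<partial>lborel \<partial>M)"
    using g by simp
  also have "\<dots> = (\<integral>\<^sup>+x. \<integral>\<^sup>+u. indicator {0..} u * indicator {u<..} (g x) \<partial>lborel \<partial>M)"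
    by (intro nn_integral_cong) (auto split: split_indicator)
  also have "\<dots> = (\<integral>\<^sup>+u. \<integral>\<^sup>+x. indicator {0..} u * indicator {u<..} (g x) \<partial>M \<partial>lborel)"
  proof (rule Fubini'[symmetric])
    \<comment> \<open>The set \<open>{u<..}\<close> varies with \<open>u\<close>; written through
      \<open>g x - u\<close> and a fixed set, joint measurability is immediate.\<close>
    have "(\<lambda>(x, u). indicator {0..} u * indicator {0<..} (g x - u) :: ennreal)
        \<in> borel_measurable (M \<Otimes>\<^sub>M lborel)"
      by measurable
    also have "(\<lambda>(x, u). indicator {0..} u * indicator {0<..} (g x - u) :: ennreal) =
        (\<lambda>(x, u). indicator {0..} u * indicator {u<..} (g x))"
      by (auto split: split_indicator)
    finally show "\<dots> \<in> borel_measurable (M \<Otimes>\<^sub>M lborel)" .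
  qed
  also have "\<dots> = (\<integral>\<^sup>+u. indicator {0..} u * emeasure M {x \<in> space M. u < g x} \<partial>lborel)"
  proof (rule nn_integral_cong)
    fix u :: real
    have "(\<integral>\<^sup>+x. indicator {u<..} (g x) \<partial>M) = (\<integral>\<^sup>+x. indicator {x \<in> space M. u < g x} x \<partial>M)"
      by (intro nn_integral_cong) (auto split: split_indicator)
    then show "(\<integral>\<^sup>+x. indicator {0..} u * indicator {u<..} (g x) \<partial>M) =
      indicator {0..} u * emeasure M {x \<in> space M. u < g x}"
      by (simp add: nn_integral_cmult)
  qed
  finally show ?thesis .
qed

text \<open>The partition into \<open>A\<close>, its complement and empty sets is one competitor in
  the supremum, and its first term is already the claim. For probability measures half of the total
  variation would bound it; the cruder form only affects constants.\<close>

lemma TV_dist_le: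
  assumes "TV_dist \<mu> \<mu>' \<le> ennreal \<delta>" "0 \<le> \<delta>" "A \<in> sets borel"
  shows "\<bar>measure \<mu> A - measure \<mu>' A\<bar> \<le> \<delta>"
proof -
  define P where "P = (\<lambda>i::nat. if i = 0 then A else if i = 1 then - A else {})"
  have "P \<in> {A :: nat \<Rightarrow> real set. range A \<subseteq> sets borel \<and> disjoint_family A \<and> (\<Union>i. A i) = UNIV}"
    using assms(3) by (auto simp: P_def disjoint_family_on_def Compl_eq_Diff_UNIV split: if_splits)
  then have le: "(\<Sum>i. ennreal \<bar>measure \<mu> (P i) - measure \<mu>' (P i)\<bar>) \<le> TV_dist \<mu> \<mu>'"
    unfolding TV_dist_def by (rule SUP_upper)
  have "ennreal \<bar>measure \<mu> A - measure \<mu>' A\<bar> =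
      (\<Sum>i<1. ennreal \<bar>measure \<mu> (P i) - measure \<mu>' (P i)\<bar>)"
    by (simp add: P_def)
  also have "\<dots> \<le> (\<Sum>i. ennreal \<bar>measure \<mu> (P i) - measure \<mu>' (P i)\<bar>)"
    by (rule sum_le_suminf) auto
  finally have "ennreal \<bar>measure \<mu> A - measure \<mu>' A\<bar> \<le> ennreal \<delta>"
    using le assms(1) by (meson order_trans)
  then show ?thesis using assms(2) by simp
qed

text \<open>In the layer cake formula the two measures are compared level by level. Levels
  \<open>u \<ge> B\<close> have empty sets, so the error \<delta> is integrated over an interval of
  length \<open>B\<close> only. The bound is one-sided; it is applied twice with the measures
  exchanged.\<close>

lemma integral_le_of_measure_le:
  assumes "prob_space \<mu>" "prob_space \<mu>'" and sets: "sets \<mu> = sets borel" "sets \<mu>' = sets borel"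
    and [measurable]: "g \<in> borel_measurable borel" and g: "\<And>x. 0 \<le> g x" "\<And>x. g x \<le> B"
    and le: "\<And>A. A \<in> sets borel \<Longrightarrow> measure \<mu> A \<le> measure \<mu>' A + \<delta>" and "0 \<le> \<delta>"
  shows "(LINT x|\<mu>. g x) \<le> (LINT x|\<mu>'. g x) + B * \<delta>"
proof -
  interpret \<mu>: prob_space \<mu> by fact
  interpret \<mu>': prob_space \<mu>' by fact
  note sets[measurable_cong]
  have sp: "space \<mu> = UNIV" "space \<mu>' = UNIV"
    using sets_eq_imp_space_eq[OF sets(1)] sets_eq_imp_space_eq[OF sets(2)] by auto
  have B: "0 \<le> B" using g order_trans by blast
  have int: "integrable \<mu> g" "integrable \<mu>' g"
    using g by (auto intro!: \<mu>.integrable_const_bound[of _ B] \<mu>'.integrable_const_bound[of _ B])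
  have [measurable]: "(\<lambda>u. emeasure \<mu>' {x \<in> space \<mu>'. u < g x}) \<in> borel_measurable lborel"
    by measurable
  have "(\<integral>\<^sup>+x. ennreal (g x) \<partial>\<mu>) =
      (\<integral>\<^sup>+u. indicator {0..} u * emeasure \<mu> {x \<in> space \<mu>. u < g x} \<partial>lborel)"
    by (intro layer_cake) (auto intro: g \<mu>.sigma_finite_measure_axioms)
  also have "\<dots> \<le> (\<integral>\<^sup>+u. indicator {0..} u * emeasure \<mu>' {x \<in> space \<mu>'. u < g x}
      + ennreal \<delta> * indicator {0..<B} u \<partial>lborel)"
  proof (rule nn_integral_mono)
    fix u :: real
    have A: "{x. u < g x} \<in> sets borel" by measurable
    have "emeasure \<mu> {x. u < g x} \<le> emeasure \<mu>' {x. u < g x} + ennreal \<delta>"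
      using le[OF A] \<open>0 \<le> \<delta>\<close>
      by (simp add: \<mu>.emeasure_eq_measure \<mu>'.emeasure_eq_measure flip: ennreal_plus)
    moreover have "{x. u < g x} = {}" if "u \<ge> B" using g that
      by (auto simp: not_less intro: order_trans)
    ultimately show "indicator {0..} u * emeasure \<mu> {x \<in> space \<mu>. u < g x}
      \<le> indicator {0..} u * emeasure \<mu>' {x \<in> space \<mu>'. u < g x} + ennreal \<delta> * indicator {0..<B} u"
      by (auto simp: sp split: split_indicator)
  qed
  also have "\<dots> = (\<integral>\<^sup>+u. indicator {0..} u * emeasure \<mu>' {x \<in> space \<mu>'. u < g x} \<partial>lborel)
      + ennreal \<delta> * ennreal B"
    using B by (subst nn_integral_add) (auto simp: nn_integral_cmult_indicator)
  also have "\<dots> = (\<integral>\<^sup>+x. ennreal (g x) \<partial>\<mu>') + ennreal \<delta> * ennreal B"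
    by (subst layer_cake) (auto intro: g \<mu>'.sigma_finite_measure_axioms)
  finally have "ennreal (LINT x|\<mu>. g x) \<le> ennreal ((LINT x|\<mu>'. g x) + B * \<delta>)"
    using int g B \<open>0 \<le> \<delta>\<close>
    by (simp add: nn_integral_eq_integral ennreal_plus ennreal_mult mult.commute integral_nonneg)
  moreover have "0 \<le> (LINT x|\<mu>'. g x) + B * \<delta>"
    using g B \<open>0 \<le> \<delta>\<close> by (intro add_nonneg_nonneg integral_nonneg mult_nonneg_nonneg) auto
  ultimately show ?thesis by simp
qed

text \<open>
  Interpolation between \<open>\<bar>z\<bar>\<close> (for the Lipschitz part of \<open>f\<close>) and the total variation (for the
  bounded part), balanced at the scale \<open>h = 1 / (p + 1)\<close>. The shift by 1 avoids the case \<open>p = 0\<close>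
  and costs nothing against a finite measure \<open>\<rho>\<close>.
\<close>

lemma (in prob_space) TV_interpolation:
  fixes f :: "real \<Rightarrow> real"
  assumes f: "\<And>x y. \<bar>f x - f y\<bar> \<le> H * \<bar>x - y\<bar> powr \<eta>" and "0 < \<eta>" "\<eta> < 1" "0 < H"
    and [measurable]: "Y \<in> borel_measurable M"
    and int: "\<And>x. integrable M (\<lambda>\<omega>. f (x + Y \<omega>))"
    and TV: "TV_dist (distr M borel (\<lambda>\<omega>. z + Y \<omega>)) (distr M borel Y) \<le> ennreal (\<bar>z\<bar> * p)"
    and "0 \<le> p"
  shows "\<bar>(LINT \<omega>|M. f (x + z + Y \<omega>)) - (LINT \<omega>|M. f (x + Y \<omega>))\<bar>
    \<le> \<bar>z\<bar> * (2 * H * (p + 1) powr (1 - \<eta>))"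
proof -
  define h where "h = 1 / (p + 1)"
  have h: "0 < h" using \<open>0 \<le> p\<close> by (simp add: h_def)
  obtain g where lip: "\<And>x y. \<bar>g x - g y\<bar> \<le> H * h powr (\<eta> - 1) * \<bar>x - y\<bar>"
    and g: "\<And>x. 0 \<le> f x - g x" "\<And>x. f x - g x \<le> H * h powr \<eta>"
    using Hoelder_split[OF f \<open>0 < \<eta>\<close> \<open>\<eta> < 1\<close> h \<open>0 < H\<close>] by metis
  have [measurable]: "f \<in> borel_measurable borel"
    using Hoelder_isCont[OF f \<open>0 < \<eta>\<close>]
    by (intro borel_measurable_continuous_onI continuous_at_imp_continuous_on) auto
  have "isCont g x" for x
    by (rule Hoelder_isCont[of g "H * h powr (\<eta> - 1)" 1]) (use lip in auto)
  then have [measurable]: "g \<in> borel_measurable borel"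
    by (intro borel_measurable_continuous_onI continuous_at_imp_continuous_on) auto
  let ?k = "\<lambda>y. f (x + y) - g (x + y)"
  let ?\<mu> = "distr M borel (\<lambda>\<omega>. z + Y \<omega>)" and ?\<mu>' = "distr M borel Y"
  have P: "prob_space ?\<mu>" "prob_space ?\<mu>'" by (auto intro!: prob_space_distr)
  note tv = TV_dist_le[OF TV]
  have zp: "0 \<le> \<bar>z\<bar> * p" using \<open>0 \<le> p\<close> by simp
  have k1: "(LINT y|?\<mu>. ?k y) \<le> (LINT y|?\<mu>'. ?k y) + (H * h powr \<eta>) * (\<bar>z\<bar> * p)"
  proof (rule integral_le_of_measure_le)
    show "measure ?\<mu> A \<le> measure ?\<mu>' A + \<bar>z\<bar> * p" if "A \<in> sets borel" for A
      using tv[OF zp that] by linarith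
  qed (use P g zp in auto)
  have k2: "(LINT y|?\<mu>'. ?k y) \<le> (LINT y|?\<mu>. ?k y) + (H * h powr \<eta>) * (\<bar>z\<bar> * p)"
  proof (rule integral_le_of_measure_le)
    show "measure ?\<mu>' A \<le> measure ?\<mu> A + \<bar>z\<bar> * p" if "A \<in> sets borel" for A
      using tv[OF zp that] by linarith
  qed (use P g zp in auto)
  have kint: "integrable M (\<lambda>\<omega>. f (w + Y \<omega>) - g (w + Y \<omega>))" for w
    using g by (intro integrable_const_bound[of _ "H * h powr \<eta>"]) auto
  have gint: "integrable M (\<lambda>\<omega>. g (w + Y \<omega>))" for w
    using Bochner_Integration.integrable_diff[OF int[of w] kint[of w]] by simp
  have e1: "(LINT y|?\<mu>. ?k y) = (LINT \<omega>|M. f (x + z + Y \<omega>)) - (LINT \<omega>|M. g (x + z + Y \<omega>))"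
    by (subst integral_distr) (auto simp: add.assoc[symmetric] int gint)
  have e2: "(LINT y|?\<mu>'. ?k y) = (LINT \<omega>|M. f (x + Y \<omega>)) - (LINT \<omega>|M. g (x + Y \<omega>))"
    by (subst integral_distr) (auto simp: int gint)
  have "\<bar>(LINT \<omega>|M. g (x + z + Y \<omega>)) - (LINT \<omega>|M. g (x + Y \<omega>))\<bar>
      = \<bar>LINT \<omega>|M. g (x + z + Y \<omega>) - g (x + Y \<omega>)\<bar>"
    by (simp add: gint)
  also have "\<dots> \<le> (LINT \<omega>|M. \<bar>g (x + z + Y \<omega>) - g (x + Y \<omega>)\<bar>)"
    by (rule integral_abs_bound)
  also have "\<dots> \<le> (LINT \<omega>|M. H * h powr (\<eta> - 1) * \<bar>z\<bar>)"
  proof (rule integral_mono)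
    fix \<omega> show "\<bar>g (x + z + Y \<omega>) - g (x + Y \<omega>)\<bar> \<le> H * h powr (\<eta> - 1) * \<bar>z\<bar>"
      using lip[of "x + z + Y \<omega>" "x + Y \<omega>"] by simp
  qed (auto simp: gint)
  finally have g3: "\<bar>(LINT \<omega>|M. g (x + z + Y \<omega>)) - (LINT \<omega>|M. g (x + Y \<omega>))\<bar>
    \<le> H * h powr (\<eta> - 1) * \<bar>z\<bar>" by (simp add: prob_space)
  \<comment> \<open>The choice of \<open>h\<close> balances the Lipschitz error
    \<open>H * h powr (\<eta> - 1) * \<bar>z\<bar>\<close> and the total variation error
    \<open>H * h powr \<eta> * \<bar>z\<bar> * p\<close>: both are at most
    \<open>H * \<bar>z\<bar> * (p + 1) powr (1 - \<eta>)\<close>, whence the factor 2.\<close>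
  have h1: "h powr (\<eta> - 1) = (p + 1) powr (1 - \<eta>)"
    using \<open>0 \<le> p\<close> by (simp add: h_def powr_divide powr_minus_divide[of _ "\<eta> - 1", symmetric])
  have "h powr \<eta> * p \<le> h powr \<eta> * (p + 1)"
    by (intro mult_left_mono) auto
  also have "\<dots> = (p + 1) powr (1 - \<eta>)"
    using \<open>0 \<le> p\<close> by (simp add: h_def powr_divide powr_diff)
  finally have h2: "h powr \<eta> * p \<le> (p + 1) powr (1 - \<eta>)" .
  have "(H * \<bar>z\<bar>) * (h powr \<eta> * p) \<le> (H * \<bar>z\<bar>) * (p + 1) powr (1 - \<eta>)"
    using \<open>0 < H\<close> h2 by (intro mult_left_mono) auto
  then have "(H * h powr \<eta>) * (\<bar>z\<bar> * p) + H * h powr (\<eta> - 1) * \<bar>z\<bar>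
      \<le> \<bar>z\<bar> * (2 * H * (p + 1) powr (1 - \<eta>))"
    by (simp add: h1 algebra_simps)
  then show ?thesis using k1 k2 g3 unfolding e1 e2 by linarith
qed

subsection \<open>Difference quotients averaged by \<open>\<rho>\<close>\<close>

text \<open>Division by 0 yields 0, so the integrand vanishes at \<open>z = 0\<close> and the
  integral agrees with the one over nonzero \<open>z\<close>.\<close>

definition diffquot :: "real measure \<Rightarrow> (real \<Rightarrow> real) \<Rightarrow> real \<Rightarrow> real" where
  "diffquot \<rho> u x = (LINT z|\<rho>. (u (x + z) - u x) / z)"

lemma D_rho_eq_diffquot: "D_rho \<rho> F t x = diffquot \<rho> (F t) x"
  unfolding D_rho_def diffquot_def set_lebesgue_integral_def
  by (intro Bochner_Integration.integral_cong) (auto split: split_indicator)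

text \<open>\<open>u\<close> stands for \<open>F t\<close>. The majorant \<open>Q\<close> of the
  quotient does not depend on \<open>x\<close>; this uniformity gives boundedness, continuity and
  Fubini. Monotonicity and the Hoelder bound are added only where sign and size of the quotient
  matter.\<close>

locale dominated_diffquot = prob_space \<rho> for \<rho> :: "real measure" +
  fixes u Q :: "real \<Rightarrow> real"
  assumes sets_rho [measurable_cong]: "sets \<rho> = sets borel"
    and Q: "integrable \<rho> Q"
    and dom: "\<And>x z. \<bar>u (x + z) - u x\<bar> \<le> \<bar>z\<bar> * Q z"
    and Q_nonneg: "\<And>z. 0 \<le> Q z"
    and cont: "\<And>x. isCont u x"
begin

lemma u_measurable [measurable]: "u \<in> borel_measurable borel"
  using cont by (intro borel_measurable_continuous_onI continuous_at_imp_continuous_on) auto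

lemma quot_le: "\<bar>(u (x + z) - u x) / z\<bar> \<le> Q z"
  using dom[of x z] Q_nonneg[of z] by (cases "z = 0") (auto simp: abs_divide pos_divide_le_eq mult.commute)

lemma integrable_quot: "integrable \<rho> (\<lambda>z. (u (x + z) - u x) / z)"
  using quot_le Q_nonneg by (intro Bochner_Integration.integrable_bound[OF Q]) (auto simp del: abs_divide)

lemma abs_diffquot_le: "\<bar>diffquot \<rho> u x\<bar> \<le> (LINT z|\<rho>. Q z)"
proof -
  have "\<bar>diffquot \<rho> u x\<bar> \<le> (LINT z|\<rho>. \<bar>(u (x + z) - u x) / z\<bar>)"
    unfolding diffquot_def by (rule integral_abs_bound)
  also have "\<dots> \<le> (LINT z|\<rho>. Q z)"
    by (intro integral_mono integrable_abs integrable_quot Q quot_le)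
  finally show ?thesis .
qed

lemma isCont_diffquot: "isCont (diffquot \<rho> u) x"
  unfolding continuous_at_sequentially comp_def
proof (intro allI impI)
  fix y assume y: "y \<longlonglongrightarrow> x"
  show "(\<lambda>n. diffquot \<rho> u (y n)) \<longlonglongrightarrow> diffquot \<rho> u x"
    unfolding diffquot_def
  proof (rule integral_dominated_convergence[OF _ _ Q])
    show "AE z in \<rho>. (\<lambda>n. (u (y n + z) - u (y n)) / z) \<longlonglongrightarrow> (u (x + z) - u x) / z"
    proof (rule AE_I2)
      fix z
      have "(\<lambda>n. (u (y n + z) - u (y n)) * inverse z) \<longlonglongrightarrow> (u (x + z) - u x) * inverse z"
        by (intro tendsto_intros isCont_tendsto_compose[OF cont] y)
      then show "(\<lambda>n. (u (y n + z) - u (y n)) / z) \<longlonglongrightarrow> (u (x + z) - u x) / z"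
        by (simp add: divide_inverse)
    qed
  qed (use quot_le in auto)
qed

lemma diffquot_measurable [measurable]: "diffquot \<rho> u \<in> borel_measurable borel"
  using isCont_diffquot
  by (intro borel_measurable_continuous_onI continuous_at_imp_continuous_on) auto

lemma quot_nonneg: "mono u \<Longrightarrow> 0 \<le> (u (x + z) - u x) / z"
  by (cases z "0 :: real" rule: linorder_cases) (auto simp: zero_le_divide_iff mono_def)

lemma diffquot_nonneg: "mono u \<Longrightarrow> 0 \<le> diffquot \<rho> u x"
  unfolding diffquot_def by (intro Bochner_Integration.integral_nonneg quot_nonneg)

text \<open>
  \<open>u\<close> grows sublinearly, so for each fixed \<open>z\<close> the telescoping averages of the difference
  quotient over \<open>x = 0, \<dots>, N - 1\<close> tend to 0.
\<close>

lemma diffquot_arbitrarily_small: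
  assumes "mono u" and H: "\<And>x y. \<bar>u x - u y\<bar> \<le> H * \<bar>x - y\<bar> powr \<eta>" and "0 < \<eta>" "\<eta> < 1"
    and "0 < e"
  shows "\<exists>x. diffquot \<rho> u x < e"
proof -
  define A where "A N z = (\<Sum>k<N. (u (real k + z) - u (real k)) / z) / real N" for N z
  have A_bound: "\<bar>A N z\<bar> \<le> Q z" for N z
  proof (cases "N = 0")
    case False
    have "\<bar>\<Sum>k<N. (u (real k + z) - u (real k)) / z\<bar> \<le> (\<Sum>k<N. Q z)"
      by (rule order_trans[OF sum_abs]) (intro sum_mono quot_le)
    then show ?thesis using False by (simp add: A_def pos_divide_le_eq mult.commute)
  qed (simp add: A_def Q_nonneg)
  \<comment> \<open>A double sum of unit increments, summed in the other order: \<open>N\<close>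
    increments of length \<open>m\<close> become \<open>m\<close> increments of length
    \<open>N\<close>. Each of the latter is at most \<open>H * real N powr \<eta>\<close>, which is
    o(N).\<close>
  have tele: "(\<Sum>k<N. u (real k + c + real m) - u (real k + c))
      = (\<Sum>j<m. u (real N + c + real j) - u (c + real j))" for N m c
  proof (induction m)
    case (Suc m)
    have "(\<Sum>k<N. u (real k + c + real (Suc m)) - u (real k + c)) =
       (\<Sum>k<N. u (real k + c + real m) - u (real k + c))
       + (\<Sum>k<N. u (real (Suc k) + c + real m) - u (real k + c + real m))"
      by (subst sum.distrib[symmetric]) (intro sum.cong, auto simp: algebra_simps)
    also have "(\<Sum>k<N. u (real (Suc k) + c + real m) - u (real k + c + real m))
       = u (real N + c + real m) - u (c + real m)"
      by (subst sum_lessThan_telescope) simp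
    finally show ?case using Suc.IH by simp
  qed simp
  have block: "(\<Sum>k<N. u (real k + c + real m) - u (real k + c)) \<le> real m * (H * real N powr \<eta>)"
    for N m c
  proof -
    have "(\<Sum>j<m. u (real N + c + real j) - u (c + real j)) \<le> (\<Sum>j<m. H * real N powr \<eta>)"
    proof (rule sum_mono)
      fix j show "u (real N + c + real j) - u (c + real j) \<le> H * real N powr \<eta>"
        using H[of "real N + c + real j" "c + real j"] by simp
    qed
    then show ?thesis unfolding tele by simp
  qed
  have A_nonneg: "0 \<le> A N z" for N z
    unfolding A_def by (intro divide_nonneg_nonneg sum_nonneg quot_nonneg \<open>mono u\<close>) auto
  have lim0: "(\<lambda>N. A N z) \<longlonglongrightarrow> 0" for z
  proof (cases "z = 0")
    case True
    then show ?thesis by (simp add: A_def)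
  next
    case False
    define m where "m = nat \<lceil>\<bar>z\<bar>\<rceil>"
    have m: "\<bar>z\<bar> \<le> real m" unfolding m_def by linarith
    \<comment> \<open>\<open>c\<close> is the left end of the interval between 0 and
      \<open>z\<close>. The quotient is the increment over this interval divided by its length, for
      either sign of \<open>z\<close>, and monotonicity allows enlarging the interval to the integer
      length \<open>m\<close>.\<close>
    define c where "c = min z 0"
    have le: "(u (real k + z) - u (real k)) / z \<le> (u (real k + c + real m) - u (real k + c)) / \<bar>z\<bar>"
      for k
    proof -
      have "u (real k + z) \<le> u (real k + c + real m)" if "z > 0"
        using that m by (intro monoD[OF \<open>mono u\<close>]) (auto simp: c_def)
      moreover have "u (real k) \<le> u (real k + c + real m)" if "z < 0"
        using that m by (intro monoD[OF \<open>mono u\<close>]) (auto simp: c_def)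
      ultimately show ?thesis
        using False by (cases "z > 0") (auto simp: c_def divide_simps)
    qed
    have A_le: "A N z \<le> real m * H / \<bar>z\<bar> * real N powr (\<eta> - 1)" if "N > 0" for N
    proof -
      have "(\<Sum>k<N. (u (real k + z) - u (real k)) / z) \<le>
          (\<Sum>k<N. (u (real k + c + real m) - u (real k + c)) / \<bar>z\<bar>)"
        by (intro sum_mono le)
      also have "\<dots> \<le> real m * (H * real N powr \<eta>) / \<bar>z\<bar>"
        unfolding sum_divide_distrib[symmetric] by (intro divide_right_mono block) auto
      finally have "A N z \<le> (real m * (H * real N powr \<eta>) / \<bar>z\<bar>) / real N"
        unfolding A_def by (intro divide_right_mono) auto
      also have "\<dots> = real m * H / \<bar>z\<bar> * real N powr (\<eta> - 1)"
        using that by (simp add: powr_diff)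
      finally show ?thesis .
    qed
    have "(\<lambda>N. real N powr (\<eta> - 1)) \<longlonglongrightarrow> 0"
      using \<open>\<eta> < 1\<close> tendsto_neg_powr[OF _ filterlim_real_sequentially, of "\<eta> - 1"] by simp
    then have "(\<lambda>N. real m * H / \<bar>z\<bar> * real N powr (\<eta> - 1)) \<longlonglongrightarrow> 0"
      by (rule tendsto_mult_right_zero)
    then show ?thesis
      by (rule tendsto_sandwich[rotated 2, OF tendsto_const])
         (use A_nonneg A_le in \<open>auto intro: eventually_sequentiallyI[of 1]\<close>)
  qed
  have [measurable]: "A N \<in> borel_measurable \<rho>" for N
    unfolding A_def by measurable
  have "(\<lambda>N. LINT z|\<rho>. A N z) \<longlonglongrightarrow> (LINT z|\<rho>. 0)"
    by (rule integral_dominated_convergence[OF _ _ Q]) (use A_bound lim0 in auto)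
  then have "eventually (\<lambda>N. (LINT z|\<rho>. A N z) < e) sequentially"
    using \<open>0 < e\<close> by (intro order_tendstoD) auto
  then obtain N where N: "N > 0" "(LINT z|\<rho>. A N z) < e"
    using eventually_happens[OF eventually_conj[OF eventually_gt_at_top[of 0]]] by auto
  have "(LINT z|\<rho>. A N z) = (\<Sum>k<N. diffquot \<rho> u (real k)) / real N"
    unfolding A_def diffquot_def using integrable_quot by simp
  with N have "(\<Sum>k<N. diffquot \<rho> u (real k)) < (\<Sum>k<N. e)"
    by (simp add: pos_divide_less_eq mult.commute)
  then obtain k where "diffquot \<rho> u (real k) < e"
    by (meson not_less sum_mono)
  then show ?thesis by blast
qed

text \<open>Fubini, with \<open>Q\<close> as a majorant on the product. This lets averaging over an
  increment of the process pass through the \<rho>-integral.\<close>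

lemma integral_diffquot_shift:
  assumes "prob_space \<mu>" and [measurable_cong]: "sets \<mu> = sets borel"
    and int: "\<And>x. integrable \<mu> (\<lambda>y. u (x + y))"
  shows "(LINT y|\<mu>. diffquot \<rho> u (x + y)) = diffquot \<rho> (\<lambda>x. LINT y|\<mu>. u (x + y)) x"
proof -
  interpret \<mu>: prob_space \<mu> by fact
  interpret P: pair_prob_space \<mu> \<rho> ..
  interpret P': pair_prob_space \<rho> \<mu> ..
  have int2: "integrable (\<mu> \<Otimes>\<^sub>M \<rho>) (\<lambda>(y, z). (u (x + y + z) - u (x + y)) / z)"
  proof (rule Bochner_Integration.integrable_bound[where f = "\<lambda>(y, z). Q z"])
    show "AE p in \<mu> \<Otimes>\<^sub>M \<rho>. norm (case p of (y, z) \<Rightarrow> (u (x + y + z) - u (x + y)) / z)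
        \<le> norm (case p of (y, z) \<Rightarrow> Q z)"
      using quot_le Q_nonneg by (intro AE_I2) (auto simp del: abs_divide)
    \<comment> \<open>\<open>Q\<close> depends on the \<rho>-coordinate alone, so its integrability
      on the product follows from the marginal law; the factors are then swapped.\<close>
    have "integrable (distr (\<rho> \<Otimes>\<^sub>M \<mu>) \<rho> fst) Q"
      using Q by (simp add: \<mu>.distr_pair_fst)
    then have "integrable (\<rho> \<Otimes>\<^sub>M \<mu>) (\<lambda>p. Q (fst p))"
      by (rule integrable_distr[rotated]) simp
    from P'.integrable_product_swap[OF this]
    show "integrable (\<mu> \<Otimes>\<^sub>M \<rho>) (\<lambda>(y, z). Q z)"
      by simp
  qed measurable
  have "(LINT y|\<mu>. diffquot \<rho> u (x + y)) = (LINT y|\<mu>. LINT z|\<rho>. (u (x + y + z) - u (x + y)) / z)"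
    by (simp add: diffquot_def)
  also have "\<dots> = (LINT z|\<rho>. LINT y|\<mu>. (u (x + y + z) - u (x + y)) / z)"
    using P.Fubini_integral[OF int2] by simp
  also have "\<dots> = (LINT z|\<rho>. ((LINT y|\<mu>. u (x + z + y)) - (LINT y|\<mu>. u (x + y))) / z)"
  proof (intro Bochner_Integration.integral_cong refl)
    fix z
    have e: "x + y + z = x + z + y" for y by simp
    show "(LINT y|\<mu>. (u (x + y + z) - u (x + y)) / z)
       = ((LINT y|\<mu>. u (x + z + y)) - (LINT y|\<mu>. u (x + y))) / z"
      using int[of x] int[of "x + z"] by (simp add: e)
  qed
  finally show ?thesis by (simp add: diffquot_def)
qed

end

subsection \<open>Increments of Levy processes\<close>

locale levy = prob_space M for M :: "'a measure" +
  fixes T :: real and X :: "real \<Rightarrow> 'a \<Rightarrow> real"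
  assumes T_pos: "0 < T" and levy: "levy_process M T X"
begin

lemma X_measurable [measurable]: "t \<in> {0..T} \<Longrightarrow> X t \<in> borel_measurable M"
  using levy by (auto simp: levy_process_def)

lemma X_0: "\<omega> \<in> space M \<Longrightarrow> X 0 \<omega> = 0"
  using levy by (auto simp: levy_process_def)

lemma distr_increment:
  "0 \<le> s \<Longrightarrow> s \<le> t \<Longrightarrow> t \<le> T \<Longrightarrow>
    distr M borel (\<lambda>\<omega>. X t \<omega> - X s \<omega>) = distr M borel (X (t - s))"
  using levy by (auto simp: levy_process_def)

lemma indep_increments:
  fixes t :: "nat \<Rightarrow> real"
  shows "0 \<le> t 0 \<Longrightarrow> (\<And>i. i < n \<Longrightarrow> t i < t (Suc i)) \<Longrightarrow> t n \<le> T \<Longrightarrow>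
    indep_vars (\<lambda>_. borel) (\<lambda>i \<omega>. X (t (Suc i)) \<omega> - X (t i) \<omega>) {..<n}"
  using levy unfolding levy_process_def by blast

lemma prob_increment:
  assumes "0 \<le> s" "s \<le> t" "t \<le> T" "A \<in> sets borel"
  shows "prob {\<omega> \<in> space M. X t \<omega> - X s \<omega> \<in> A} = prob {\<omega> \<in> space M. X (t - s) \<omega> \<in> A}"
proof -
  have "measure (distr M borel (\<lambda>\<omega>. X t \<omega> - X s \<omega>)) A = measure (distr M borel (X (t - s))) A"
    using assms by (simp add: distr_increment)
  then show ?thesis using assms
    by (simp add: measure_distr) (simp add: vimage_def Int_def conj_commute)
qed

text \<open>Reflection reduces negative points of the support to nonnegative ones.\<close>

lemma levy_process_uminus: "levy_process M T (\<lambda>t \<omega>. - X t \<omega>)"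
  unfolding levy_process_def
proof (intro conjI allI impI ballI)
  show "(\<lambda>\<omega>. - X t \<omega>) \<in> borel_measurable M" if "t \<in> {0..T}" for t
    using that by measurable
  show "- X 0 \<omega> = 0" if "\<omega> \<in> space M" for \<omega> using X_0[OF that] by simp
next
  fix s t assume st: "0 \<le> s \<and> s \<le> t \<and> t \<le> T"
  have "distr M borel (\<lambda>\<omega>. - X t \<omega> - - X s \<omega>) = distr (distr M borel (\<lambda>\<omega>. X t \<omega> - X s \<omega>)) borel uminus"
    using st by (subst distr_distr) (auto simp: comp_def)
  also have "\<dots> = distr (distr M borel (X (t - s))) borel uminus"
    using st by (simp add: distr_increment)
  also have "\<dots> = distr M borel (\<lambda>\<omega>. - X (t - s) \<omega>)"
    using st by (subst distr_distr) (auto simp: comp_def)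
  finally show "distr M borel (\<lambda>\<omega>. - X t \<omega> - - X s \<omega>) = distr M borel (\<lambda>\<omega>. - X (t - s) \<omega>)" .
next
  fix n :: nat and t assume "0 \<le> t 0 \<and> (\<forall>i<n. t i < t (Suc i)) \<and> t n \<le> T"
  then have "indep_vars (\<lambda>_. borel) (\<lambda>i \<omega>. X (t (Suc i)) \<omega> - X (t i) \<omega>) {..<n}"
    by (intro indep_increments) auto
  then have "indep_vars (\<lambda>_. borel) (\<lambda>i \<omega>. - (X (t (Suc i)) \<omega> - X (t i) \<omega>)) {..<n}"
    by (rule indep_vars_compose2) simp
  then show "indep_vars (\<lambda>_. borel) (\<lambda>i \<omega>. - X (t (Suc i)) \<omega> - - X (t i) \<omega>) {..<n}"
    by simp
next
  fix \<omega> assume "\<omega> \<in> space M"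
  then have "cadlag_on {0..T} (\<lambda>t. X t \<omega>)" using levy by (simp add: levy_process_def)
  then show "cadlag_on {0..T} (\<lambda>t. - X t \<omega>)"
    unfolding cadlag_on_def using tendsto_minus by blast
qed

lemma X_right_continuous_0:
  assumes "\<omega> \<in> space M" "0 < a"
  obtains \<delta> where "0 < \<delta>" "\<And>t. 0 \<le> t \<Longrightarrow> t < \<delta> \<Longrightarrow> t \<le> T \<Longrightarrow> \<bar>X t \<omega>\<bar> < a"
proof -
  have "cadlag_on {0..T} (\<lambda>t. X t \<omega>)" using levy assms by (simp add: levy_process_def)
  then have "((\<lambda>t. X t \<omega>) \<longlongrightarrow> X 0 \<omega>) (at 0 within {0..T} \<inter> {0<..})"
    using T_pos unfolding cadlag_on_def by force
  then have "eventually (\<lambda>t. dist (X t \<omega>) (X 0 \<omega>) < a) (at 0 within {0..T} \<inter> {0<..})"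
    using \<open>0 < a\<close> by (rule tendstoD)
  then obtain d where d: "d > 0"
    "\<And>t. t \<in> {0..T} \<inter> {0<..} \<Longrightarrow> t \<noteq> 0 \<Longrightarrow> dist t 0 < d \<Longrightarrow> dist (X t \<omega>) (X 0 \<omega>) < a"
    unfolding eventually_at by auto
  show ?thesis
  proof (rule that[OF d(1)])
    fix t assume "0 \<le> t" "t < d" "t \<le> T"
    then show "\<bar>X t \<omega>\<bar> < a"
      using d(2)[of t] X_0[OF assms(1)] \<open>0 < a\<close> by (cases "t = 0") (auto simp: dist_real_def)
  qed
qed

subsection \<open>Independence from the past\<close>

text \<open>The times of the cylinder are sorted into a grid ending at \<open>s\<close>, and
  \<open>t\<close> is appended. The past values are partial sums of the increments on the grid,
  hence a function of all increments but the last, and the last one is independent of them.\<close>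

lemma prob_cylinder_increment:
  assumes J: "finite J" "J \<subseteq> {0..s}" and B: "\<And>u. u \<in> J \<Longrightarrow> B u \<in> sets borel"
    and st: "0 \<le> s" "s < t" "t \<le> T" and C: "C \<in> sets borel"
  shows "prob ({\<omega> \<in> space M. \<forall>u\<in>J. X u \<omega> \<in> B u} \<inter> {\<omega> \<in> space M. X t \<omega> - X s \<omega> \<in> C}) =
    prob {\<omega> \<in> space M. \<forall>u\<in>J. X u \<omega> \<in> B u} * prob {\<omega> \<in> space M. X t \<omega> - X s \<omega> \<in> C}"
proof -
  \<comment> \<open>With 0 in the grid the increments sum up to the values of \<open>X\<close>; with
    \<open>s\<close> in it the last increment starts exactly at \<open>s\<close>.\<close>
  define J' where "J' = insert 0 (insert s J)"
  have J': "finite J'" "J' \<subseteq> {0..s}" using J st by (auto simp: J'_def)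
  define l where "l = sorted_list_of_set J'"
  have l: "sorted l" "distinct l" "set l = J'" using J' by (auto simp: l_def)
  have "l \<noteq> []" using l(3) by (auto simp: J'_def)
  then obtain n where n: "length l = Suc n" by (cases l) auto
  define p where "p i = (if i \<le> n then l ! i else t)" for i
  have strict: "l ! i < l ! j" if "i < j" "j \<le> n" for i j
    using sorted_nth_mono[OF l(1), of i j] nth_eq_iff_index_eq[OF l(2), of i j] that n by force
  have p_mem: "p i \<in> J'" if "i \<le> n" for i
    using that n nth_mem[of i l] l(3) by (auto simp: p_def)
  have p_ex: "\<exists>i\<le>n. p i = u" if "u \<in> J'" for u
    using that n unfolding l(3)[symmetric] in_set_conv_nth by (force simp: p_def)
  have mono: "p i \<le> p j" if "i \<le> j" "j \<le> n" for i j
    using strict[of i j] that by (cases "i = j") (auto simp: p_def)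
  have p0: "p 0 = 0"
  proof -
    obtain i where "i \<le> n" "p i = 0" using p_ex[of 0] by (auto simp: J'_def)
    then show ?thesis using mono[of 0 i] p_mem[of 0] J'(2) by force
  qed
  have pn: "p n = s"
  proof -
    obtain i where "i \<le> n" "p i = s" using p_ex[of s] by (auto simp: J'_def)
    then show ?thesis using mono[of i n] p_mem[of n] J'(2) by force
  qed
  have pSn: "p (Suc n) = t" by (simp add: p_def)
  have inc: "p i < p (Suc i)" if "i < Suc n" for i
  proof (cases "i = n")
    case True then show ?thesis using pn pSn st by simp
  next
    case False then show ?thesis using that strict[of i "Suc i"] by (simp add: p_def)
  qed
  let ?D = "\<lambda>i \<omega>. X (p (Suc i)) \<omega> - X (p i) \<omega>"
  have ind: "indep_vars (\<lambda>_. borel) ?D {..<Suc n}"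
    by (rule indep_increments) (use p0 pSn st inc in auto)
  have "\<forall>u\<in>J. \<exists>i\<le>n. p i = u" using p_ex by (auto simp: J'_def)
  then obtain k where k: "\<And>u. u \<in> J \<Longrightarrow> k u \<le> n" "\<And>u. u \<in> J \<Longrightarrow> p (k u) = u" by metis
  \<comment> \<open>The cylinder in the coordinates of the first \<open>n\<close> increments:
    \<open>X u\<close> is the sum of the first \<open>k u\<close> of them.\<close>
  define Q where "Q = {g \<in> space (PiM {..<n} (\<lambda>_. borel :: real measure)). \<forall>u\<in>J. (\<Sum>i<k u. g i) \<in> B u}"
  define R where "R = {g \<in> space (PiM {n} (\<lambda>_. borel :: real measure)). g n \<in> C}"
  have Q: "Q \<in> sets (PiM {..<n} (\<lambda>_. borel))"
    unfolding Q_def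
  proof (rule sets.sets_Collect_finite_All[OF _ J(1)])
    fix u assume u: "u \<in> J"
    have "(\<lambda>g. \<Sum>i<k u. g i) \<in> borel_measurable (PiM {..<n} (\<lambda>_. borel :: real measure))"
      using k(1)[OF u] by (intro borel_measurable_sum measurable_component_singleton) auto
    from measurable_sets[OF this B[OF u]]
    show "{g \<in> space (PiM {..<n} (\<lambda>_. borel :: real measure)). (\<Sum>i<k u. g i) \<in> B u}
        \<in> sets (PiM {..<n} (\<lambda>_. borel))"
      by (simp add: vimage_def Int_def conj_commute)
  qed
  have R: "R \<in> sets (PiM {n} (\<lambda>_. borel))"
    using measurable_sets[OF measurable_component_singleton[of n "{n}" "\<lambda>_. borel :: real measure"] C]
    by (simp add: R_def vimage_def Int_def conj_commute)
  have iv: "indep_var (PiM {..<n} (\<lambda>_. borel)) (\<lambda>\<omega>. restrict (\<lambda>i. ?D i \<omega>) {..<n})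
      (PiM {n} (\<lambda>_. borel)) (\<lambda>\<omega>. restrict (\<lambda>i. ?D i \<omega>) {n})"
    by (rule indep_var_restrict[OF ind]) auto
  have tele: "(\<Sum>i<m. ?D i \<omega>) = X (p m) \<omega>" if "\<omega> \<in> space M" for m \<omega>
    using sum_lessThan_telescope[of "\<lambda>i. X (p i) \<omega>" m] p0 X_0[OF that] by simp
  have sum_eq: "(\<Sum>i<k u. restrict (\<lambda>i. ?D i \<omega>) {..<n} i) = X u \<omega>" if "\<omega> \<in> space M" "u \<in> J" for u \<omega>
  proof -
    have "(\<Sum>i<k u. restrict (\<lambda>i. ?D i \<omega>) {..<n} i) = (\<Sum>i<k u. ?D i \<omega>)"
      using k(1)[OF that(2)] by (intro sum.cong) auto
    then show ?thesis using tele[OF that(1)] k(2)[OF that(2)] by simp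
  qed
  have vQ: "(\<lambda>\<omega>. restrict (\<lambda>i. ?D i \<omega>) {..<n}) -` Q \<inter> space M = {\<omega> \<in> space M. \<forall>u\<in>J. X u \<omega> \<in> B u}"
  proof -
    have "restrict (\<lambda>i. ?D i \<omega>) {..<n} \<in> space (PiM {..<n} (\<lambda>_. borel :: real measure))" for \<omega>
      by (simp add: space_PiM)
    then show ?thesis
      unfolding Q_def using sum_eq by (auto simp del: restrict_apply)
  qed
  have vR: "(\<lambda>\<omega>. restrict (\<lambda>i. ?D i \<omega>) {n}) -` R \<inter> space M = {\<omega> \<in> space M. X t \<omega> - X s \<omega> \<in> C}"
    unfolding R_def using pn pSn by (auto simp: space_PiM)
  have "prob ((\<lambda>\<omega>. (restrict (\<lambda>i. ?D i \<omega>) {..<n}, restrict (\<lambda>i. ?D i \<omega>) {n})) -` (Q \<times> R) \<inter> space M) =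
    prob ((\<lambda>\<omega>. restrict (\<lambda>i. ?D i \<omega>) {..<n}) -` Q \<inter> space M) *
    prob ((\<lambda>\<omega>. restrict (\<lambda>i. ?D i \<omega>) {n}) -` R \<inter> space M)"
    by (rule indep_varD[OF iv Q R])
  moreover have "(\<lambda>\<omega>. (restrict (\<lambda>i. ?D i \<omega>) {..<n}, restrict (\<lambda>i. ?D i \<omega>) {n})) -` (Q \<times> R) \<inter> space M
    = ((\<lambda>\<omega>. restrict (\<lambda>i. ?D i \<omega>) {..<n}) -` Q \<inter> space M) \<inter> ((\<lambda>\<omega>. restrict (\<lambda>i. ?D i \<omega>) {n}) -` R \<inter> space M)"
    by blast
  ultimately show ?thesis unfolding vQ vR by simp
qed

abbreviation "\<F> \<equiv> augmented_filtration M X"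

text \<open>A pi-system whose generated sigma-algebra contains the augmented filtration:
  finite-dimensional cylinders, together with the null sets that the augmentation adds. It is stable
  under intersection because a null set absorbs every event.\<close>

definition past_sets :: "real \<Rightarrow> 'a set set" where
  "past_sets s = {C. \<exists>J B. finite J \<and> J \<subseteq> {0..s} \<and> (\<forall>u\<in>J. B u \<in> sets borel) \<and>
     C = {\<omega> \<in> space M. \<forall>u\<in>J. X u \<omega> \<in> B u}} \<union> null_sets M"

lemma past_sets_events: "s \<le> T \<Longrightarrow> past_sets s \<subseteq> events"
proof
  fix A assume s: "s \<le> T" and "A \<in> past_sets s"
  then consider "A \<in> null_sets M" | J B where "finite J" "J \<subseteq> {0..s}" "\<forall>u\<in>J. B u \<in> sets borel"
     "A = {\<omega> \<in> space M. \<forall>u\<in>J. X u \<omega> \<in> B u}" by (auto simp: past_sets_def)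
  then show "A \<in> events"
  proof cases
    case 2
    show ?thesis unfolding 2(4)
    proof (rule sets.sets_Collect_finite_All[OF _ 2(1)])
      fix u assume u: "u \<in> J"
      then have "X u \<in> borel_measurable M" using 2(2) s by (intro X_measurable) auto
      from measurable_sets[OF this] show "{\<omega> \<in> space M. X u \<omega> \<in> B u} \<in> events"
        using 2(3) u by (simp add: vimage_def Int_def conj_commute)
    qed
  qed auto
qed

lemma Int_stable_past_sets:
  assumes "s \<le> T"
  shows "Int_stable (past_sets s)"
  unfolding Int_stable_def
proof (intro ballI)
  fix A A' assume A: "A \<in> past_sets s" and A': "A' \<in> past_sets s"
  show "A \<inter> A' \<in> past_sets s"
  proof (cases "A \<in> null_sets M \<or> A' \<in> null_sets M")
    case True
    then have "A \<inter> A' \<in> null_sets M"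
      using A A' past_sets_events[OF assms] by (auto intro: null_set_Int1 null_set_Int2)
    then show ?thesis by (simp add: past_sets_def)
  next
    case False
    then obtain J B J' B' where J: "finite J" "J \<subseteq> {0..s}" "\<forall>u\<in>J. B u \<in> sets borel"
       "A = {\<omega> \<in> space M. \<forall>u\<in>J. X u \<omega> \<in> B u}"
      and J': "finite J'" "J' \<subseteq> {0..s}" "\<forall>u\<in>J'. B' u \<in> sets borel"
       "A' = {\<omega> \<in> space M. \<forall>u\<in>J'. X u \<omega> \<in> B' u}"
      using A A' unfolding past_sets_def by blast
    \<comment> \<open>A time constrained by only one of the two cylinders receives
      \<open>UNIV\<close> from the other.\<close>
    let ?B = "\<lambda>u. (if u \<in> J then B u else UNIV) \<inter> (if u \<in> J' then B' u else UNIV)"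
    have "A \<inter> A' = {\<omega> \<in> space M. \<forall>u\<in>J \<union> J'. X u \<omega> \<in> ?B u}"
      unfolding J(4) J'(4) by auto
    moreover have "\<forall>u\<in>J \<union> J'. ?B u \<in> sets borel" using J(3) J'(3) by auto
    ultimately show ?thesis
      unfolding past_sets_def using J(1,2) J'(1,2)
      by (intro UnI1 CollectI exI[of _ "J \<union> J'"] exI[of _ ?B]) auto
  qed
qed

lemma sets_augmented_filtration:
  "s \<le> T \<Longrightarrow> sets (\<F> s) = sigma_sets (space M)
     ({X u -` B \<inter> space M | u B. u \<in> {0..s} \<and> B \<in> sets borel} \<union> null_sets M)"
  unfolding augmented_filtration_def
  by (intro sets_measure_of) (auto dest: sets.sets_into_space)

lemma space_augmented_filtration [simp]: "space (\<F> s) = space M"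
  unfolding augmented_filtration_def
  by (rule space_measure_of) (auto dest: sets.sets_into_space)

lemma sets_augmented_filtration_subset:
  assumes "s \<le> T"
  shows "sets (\<F> s) \<subseteq> sigma_sets (space M) (past_sets s)"
proof -
  have "X u -` B \<inter> space M \<in> past_sets s" if "u \<in> {0..s}" "B \<in> sets borel" for u B
    unfolding past_sets_def using that
    by (intro UnI1 CollectI exI[of _ "{u}"] exI[of _ "\<lambda>_. B"]) auto
  then show ?thesis
    unfolding sets_augmented_filtration[OF assms]
    by (intro sigma_sets_mono') (auto simp: past_sets_def[of s])
qed

lemma subalgebra_augmented_filtration:
  assumes "s \<le> T" shows "subalgebra M (\<F> s)"
  unfolding subalgebra_def
proof
  have "sigma_sets (space M) (past_sets s) \<subseteq> events"
    by (rule sets.sigma_sets_subset[OF past_sets_events[OF assms]])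
  then show "sets (\<F> s) \<subseteq> events" using sets_augmented_filtration_subset[OF assms] by blast
qed simp

lemma X_measurable_augmented_filtration:
  assumes "0 \<le> u" "u \<le> s" "s \<le> T"
  shows "X u \<in> borel_measurable (\<F> s)"
proof (rule measurableI)
  fix A assume "A \<in> sets (borel :: real measure)"
  then show "X u -` A \<inter> space (\<F> s) \<in> sets (\<F> s)"
    using assms unfolding sets_augmented_filtration[OF assms(3)] space_augmented_filtration
    by (intro sigma_sets.Basic) auto
qed simp

lemma null_sets_augmented_filtration: "s \<le> T \<Longrightarrow> N \<in> null_sets M \<Longrightarrow> N \<in> sets (\<F> s)"
  unfolding sets_augmented_filtration by (intro sigma_sets.Basic) auto

text \<open>Independence holds on the generators, by \<open>prob_cylinder_increment\<close> for
  cylinders and trivially for null sets, and extends to the generated sigma-algebras since both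
  generators are stable under intersection.\<close>

lemma prob_past_increment:
  assumes st: "0 \<le> s" "s < t" "t \<le> T" and A: "A \<in> sets (\<F> s)" and C: "C \<in> sets borel"
  shows "prob (A \<inter> {\<omega> \<in> space M. X t \<omega> - X s \<omega> \<in> C})
    = prob A * prob {\<omega> \<in> space M. X t \<omega> - X s \<omega> \<in> C}"
proof -
  let ?D = "\<lambda>\<omega>. X t \<omega> - X s \<omega>"
  have [measurable]: "X t \<in> borel_measurable M" "X s \<in> borel_measurable M"
    using st by (auto intro: X_measurable)
  have s: "s \<le> T" using st by simp
  define E where "E = {?D -` C \<inter> space M | C. C \<in> sets borel}"
  have "indep_set (past_sets s) E"
  proof (rule indep_setI)
    show "past_sets s \<subseteq> events" by (rule past_sets_events[OF s])
    show "E \<subseteq> events" unfolding E_def by auto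
    fix A D assume A: "A \<in> past_sets s" and "D \<in> E"
    then obtain C where C: "C \<in> sets borel" "D = ?D -` C \<inter> space M" by (auto simp: E_def)
    have D: "D = {\<omega> \<in> space M. ?D \<omega> \<in> C}" unfolding C by auto
    have "D \<in> events" using \<open>E \<subseteq> events\<close> \<open>D \<in> E\<close> by auto
    consider "A \<in> null_sets M" | J B where "finite J" "J \<subseteq> {0..s}" "\<forall>u\<in>J. B u \<in> sets borel"
      "A = {\<omega> \<in> space M. \<forall>u\<in>J. X u \<omega> \<in> B u}" using A by (auto simp: past_sets_def)
    then show "prob (A \<inter> D) = prob A * prob D"
    proof cases
      case 1
      then have "A \<inter> D \<in> null_sets M" using \<open>D \<in> events\<close> by (rule null_set_Int2)
      then show ?thesis using 1 by (simp add: null_setsD1 measure_def)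
    next
      case 2
      then show ?thesis unfolding 2(4) D using st C by (intro prob_cylinder_increment) auto
    qed
  qed
  moreover have "Int_stable E"
  proof (rule Int_stableI)
    fix a b assume "a \<in> E" "b \<in> E"
    then obtain A B where "A \<in> sets borel" "B \<in> sets borel" "a = ?D -` A \<inter> space M" "b = ?D -` B \<inter> space M"
      by (auto simp: E_def)
    then show "a \<inter> b \<in> E" unfolding E_def by (intro CollectI exI[of _ "A \<inter> B"]) auto
  qed
  ultimately have "indep_set (sigma_sets (space M) (past_sets s)) (sigma_sets (space M) E)"
    using Int_stable_past_sets[OF s] by (intro indep_set_sigma_sets) auto
  moreover have "A \<in> sigma_sets (space M) (past_sets s)"
    using A sets_augmented_filtration_subset[OF s] by blast
  moreover have "{\<omega> \<in> space M. ?D \<omega> \<in> C} \<in> sigma_sets (space M) E"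
    using C by (intro sigma_sets.Basic) (auto simp: E_def)
  ultimately show ?thesis by (rule indep_setD)
qed

text \<open>The whole past is treated as one random element: the identity from \<open>M\<close> to
  the space carrying the smaller sigma-algebra. Independence becomes a product law, and stationarity
  replaces the increment by \<open>X (t - s)\<close>, so Fubini can play the role of
  conditioning.\<close>

lemma distr_past_increment:
  assumes st: "0 \<le> s" "s < t" "t \<le> T"
  shows "distr M (\<F> s) (\<lambda>\<omega>. \<omega>) \<Otimes>\<^sub>M distr M borel (X (t - s))
    = distr M (\<F> s \<Otimes>\<^sub>M borel) (\<lambda>\<omega>. (\<omega>, X t \<omega> - X s \<omega>))"
proof -
  have [measurable]: "X t \<in> borel_measurable M" "X s \<in> borel_measurable M" "X (t - s) \<in> borel_measurable M"
    using st by (auto intro: X_measurable)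
  have s: "s \<le> T" using st by simp
  have sub: "sets (\<F> s) \<subseteq> events"
    using subalgebra_augmented_filtration[OF s] by (simp add: subalgebra_def)
  have id: "(\<lambda>\<omega>. \<omega>) \<in> M \<rightarrow>\<^sub>M \<F> s"
    using sub sets.Int_space_eq2 by (auto intro!: measurableI)
  note [measurable] = id
  interpret P1: prob_space "distr M (\<F> s) (\<lambda>\<omega>. \<omega>)" by (rule prob_space_distr) measurable
  interpret P2: prob_space "distr M borel (X (t - s))" by (rule prob_space_distr) measurable
  show ?thesis
  proof (rule pair_measure_eqI)
    fix A C assume "A \<in> sets (distr M (\<F> s) (\<lambda>\<omega>. \<omega>))" "C \<in> sets (distr M borel (X (t - s)))"
    then have A [measurable]: "A \<in> sets (\<F> s)" and C [measurable]: "C \<in> sets borel" by auto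
    have sp: "A \<subseteq> space M" using sets.sets_into_space[OF A] by simp
    have "emeasure (distr M (\<F> s \<Otimes>\<^sub>M borel) (\<lambda>\<omega>. (\<omega>, X t \<omega> - X s \<omega>))) (A \<times> C)
        = prob (A \<inter> {\<omega> \<in> space M. X t \<omega> - X s \<omega> \<in> C})"
    proof (subst emeasure_distr)
      have "(\<lambda>\<omega>. (\<omega>, X t \<omega> - X s \<omega>)) -` (A \<times> C) \<inter> space M = A \<inter> {\<omega> \<in> space M. X t \<omega> - X s \<omega> \<in> C}"
        using sp by auto
      then show "emeasure M ((\<lambda>\<omega>. (\<omega>, X t \<omega> - X s \<omega>)) -` (A \<times> C) \<inter> space M)
          = prob (A \<inter> {\<omega> \<in> space M. X t \<omega> - X s \<omega> \<in> C})"
        by (simp add: emeasure_eq_measure)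
    qed (auto intro!: measurable_Pair id)
    also have "\<dots> = prob A * prob {\<omega> \<in> space M. X (t - s) \<omega> \<in> C}"
      using prob_past_increment[OF st A C] prob_increment[of s t C] st by simp
    also have "\<dots> = emeasure (distr M (\<F> s) (\<lambda>\<omega>. \<omega>)) A * emeasure (distr M borel (X (t - s))) C"
    proof -
      have "(\<lambda>\<omega>. \<omega>) -` A \<inter> space M = A" "X (t - s) -` C \<inter> space M = {\<omega> \<in> space M. X (t - s) \<omega> \<in> C}"
        using sp by auto
      then show ?thesis
        by (subst (1 2) emeasure_distr) (auto simp: emeasure_eq_measure ennreal_mult)
    qed
    finally show "emeasure (distr M (\<F> s) (\<lambda>\<omega>. \<omega>)) A * emeasure (distr M borel (X (t - s))) C
      = emeasure (distr M (\<F> s \<Otimes>\<^sub>M borel) (\<lambda>\<omega>. (\<omega>, X t \<omega> - X s \<omega>))) (A \<times> C)" by simp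
  qed (auto intro: P1.sigma_finite_measure_axioms P2.sigma_finite_measure_axioms
        intro!: sets_pair_measure_cong)
qed

end

subsection \<open>Full support\<close>

text \<open>
  A Levy process that is charged with both signs uniformly at small times has full support:
  if the law of \<open>X\<^sub>u\<close> avoided \<open>(K u, a)\<close> for all small \<open>u\<close>, then on an event \<open>A\<close> where all dyadic
  increments are below \<open>a\<close> they would be at most \<open>K u\<close>, and by the exponential moments of the
  increments the constant \<open>K\<close> could be improved repeatedly by the factor \<open>1 - c\<close>, down to 0,
  contradicting \<open>P (X\<^sub>s > 0) \<ge> c\<close>.
\<close>

lemma exp_le_quadratic:
  fixes x :: real
  assumes "0 \<le> x" "x \<le> 1"
  shows "exp x \<le> 1 + x * (1 + x)"
  using exp_bound[OF assms] by (simp add: power2_eq_square algebra_simps)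

text \<open>The uniform constant \<open>c\<close> drives the exponential moment argument.
  \<open>charge_near_0\<close> has another purpose: a path that has come near its target can stay
  there for the remaining time.\<close>

locale two_sided_levy = levy +
  fixes c :: real
  assumes c_pos: "0 < c"
    and charge_pos: "\<And>s. s \<in> {0<..T} \<Longrightarrow> c \<le> prob {\<omega> \<in> space M. X s \<omega> > 0}"
    and charge_neg: "\<And>s. s \<in> {0<..T} \<Longrightarrow> c \<le> prob {\<omega> \<in> space M. X s \<omega> < 0}"
    and charge_near_0: "\<And>s e. s \<in> {0<..T} \<Longrightarrow> 0 < e \<Longrightarrow> 0 < prob {\<omega> \<in> space M. \<bar>X s \<omega>\<bar> < e}"
begin

lemma c_le_1: "c \<le> 1"
  using charge_pos[of T] T_pos prob_le_1 order_trans by fastforce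

text \<open>On \<open>X u < 0\<close>, an event of probability at least \<open>c\<close>, the
  integrand is at most 1; elsewhere the truncation bounds it by \<open>exp y\<close>. Hence the
  bound \<open>c + (1 - c) * exp y\<close>.\<close>

lemma expectation_exp_truncated_le:
  assumes u: "u \<in> {0<..T}" and "0 \<le> y" and "0 < l"
  shows "expectation (\<lambda>\<omega>. exp (l * X u \<omega>) * indicator {..y} (l * X u \<omega>)) \<le> 1 + (1 - c) * (exp y - 1)"
proof -
  let ?N = "{\<omega> \<in> space M. X u \<omega> < 0}"
  have [measurable]: "X u \<in> borel_measurable M" using u by (intro X_measurable) auto
  have "expectation (\<lambda>\<omega>. exp (l * X u \<omega>) * indicator {..y} (l * X u \<omega>))
      \<le> expectation (\<lambda>\<omega>. exp y - (exp y - 1) * indicator ?N \<omega>)"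
  proof (rule integral_mono)
    show "integrable M (\<lambda>\<omega>. exp (l * X u \<omega>) * indicator {..y} (l * X u \<omega>))"
      by (rule integrable_const_bound[of _ "exp y"]) (auto split: split_indicator)
    show "integrable M (\<lambda>\<omega>. exp y - (exp y - 1) * indicator ?N \<omega>)"
      by (intro Bochner_Integration.integrable_diff integrable_mult_right integrable_const)
         (simp add: integrable_indicator_iff emeasure_eq_measure)
    fix \<omega> assume \<omega>: "\<omega> \<in> space M"
    show "exp (l * X u \<omega>) * indicator {..y} (l * X u \<omega>) \<le> exp y - (exp y - 1) * indicator ?N \<omega>"
    proof (cases "X u \<omega> < 0")
      case True
      then have "l * X u \<omega> < 0" using \<open>0 < l\<close> by (simp add: mult_pos_neg)
      then have "exp (l * X u \<omega>) \<le> 1" by simp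
      then show ?thesis using True \<omega> by (auto split: split_indicator)
    qed (use \<omega> in \<open>auto split: split_indicator\<close>)
  qed
  also have "\<dots> = exp y - (exp y - 1) * prob ?N"
    by (subst Bochner_Integration.integral_diff)
       (auto simp: prob_space emeasure_eq_measure integrable_indicator_iff)
  also have "\<dots> \<le> exp y - (exp y - 1) * c"
    using charge_neg[OF u] \<open>0 \<le> y\<close> by (intro diff_left_mono mult_left_mono) auto
  finally show ?thesis by (simp add: algebra_simps)
qed

abbreviation dyadic_increment :: "real \<Rightarrow> nat \<Rightarrow> nat \<Rightarrow> 'a \<Rightarrow> real" where
  "dyadic_increment s k i \<omega> \<equiv> X (real (Suc i) * (s / 2 ^ k)) \<omega> - X (real i * (s / 2 ^ k)) \<omega>"

lemma dyadic_time_le: "0 < s \<Longrightarrow> s \<le> T \<Longrightarrow> i \<le> 2 ^ k \<Longrightarrow> real i * (s / 2 ^ k) \<le> T"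
proof -
  assume s: "0 < s" "s \<le> T" and "i \<le> 2 ^ k"
  then have "real i \<le> real (2 ^ k)" by (simp only: of_nat_le_iff)
  then have "real i * s \<le> 2 ^ k * s" using s by (intro mult_right_mono) auto
  also have "\<dots> \<le> 2 ^ k * T" using \<open>s \<le> T\<close> by simp
  finally show ?thesis by (simp add: pos_divide_le_eq mult.commute)
qed

text \<open>The interval is cut into \<open>2 ^ m\<close> pieces, each with a truncated exponential
  moment of about \<open>1 + (1 - c) * y / 2 ^ m\<close>. Independence multiplies these, and in the
  limit of large \<open>m\<close> the trivial exponent \<open>y\<close> has improved to
  \<open>(1 - c) * y\<close>.\<close>

lemma expectation_exp_dyadic_le:
  assumes s: "0 < s" "s \<le> T" and A: "A \<in> events" and "0 < l" "0 \<le> K"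
    and le: "\<And>k i. i < 2 ^ k \<Longrightarrow> AE \<omega> in M. \<omega> \<in> A \<longrightarrow> dyadic_increment s k i \<omega> \<le> K * (s / 2 ^ k)"
    and i: "i < 2 ^ k"
  shows "expectation (\<lambda>\<omega>. exp (l * dyadic_increment s k i \<omega>) * indicator A \<omega>)
    \<le> exp ((1 - c) * (l * K * (s / 2 ^ k)))"
proof -
  define y where "y = l * K * (s / 2 ^ k)"
  have y: "0 \<le> y" using assms by (auto simp: y_def)
  note [simp del] = of_nat_Suc
  let ?D = "\<lambda>j. dyadic_increment s k j"
  let ?E = "expectation (\<lambda>\<omega>. exp (l * ?D i \<omega>) * indicator A \<omega>)"
  have bound: "?E \<le> exp ((1 - c) * y * (1 + y / 2 ^ m))" if m: "y \<le> 2 ^ m" for m :: nat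
  proof -
    define u where "u = s / 2 ^ (k + m)"
    have u: "0 < u" "u \<le> T"
      using s dyadic_time_le[of s 1 "k + m"] by (auto simp: u_def)
    define I where "I = {i * 2 ^ m..<Suc i * 2 ^ m}"
    have I_lt: "j < 2 ^ (k + m)" if "j \<in> I" for j
    proof -
      have "Suc i * 2 ^ m \<le> 2 ^ k * 2 ^ m" using i by (intro mult_right_mono) auto
      then show ?thesis using that by (simp add: I_def power_add)
    qed
    have card_I: "card I = 2 ^ m" by (simp add: I_def)
    let ?d = "\<lambda>j \<omega>. X (real (Suc j) * u) \<omega> - X (real j * u) \<omega>"
    have D_sum: "?D i \<omega> = (\<Sum>j\<in>I. ?d j \<omega>)" for \<omega>
    proof -
      have "(\<Sum>j\<in>I. ?d j \<omega>) = X (real (Suc i * 2 ^ m) * u) \<omega> - X (real (i * 2 ^ m) * u) \<omega>"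
        unfolding I_def by (rule sum_Suc_diff') auto
      also have "real (Suc i * 2 ^ m) * u = real (Suc i) * (s / 2 ^ k)"
        by (simp add: u_def power_add of_nat_Suc field_simps)
      also have "real (i * 2 ^ m) * u = real i * (s / 2 ^ k)"
        by (simp add: u_def power_add)
      finally show ?thesis by simp
    qed
    have tm: "real j * u \<in> {0..T}" if "j \<le> 2 ^ (k + m)" for j
      using dyadic_time_le[OF s that, folded u_def] u by simp
    have ind: "indep_vars (\<lambda>_. borel) ?d I"
    proof (rule indep_vars_subset)
      show "indep_vars (\<lambda>_. borel) ?d {..<2 ^ (k + m)}"
        by (rule indep_increments)
           (use u tm[of "2 ^ (k + m)"] in auto)
      show "I \<subseteq> {..<2 ^ (k + m)}" using I_lt by auto
    qed
    have [measurable]: "?d j \<in> borel_measurable M" if "j \<in> I" for j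
      using I_lt[OF that] by (intro borel_measurable_diff X_measurable tm) auto
    \<comment> \<open>On \<open>A\<close> every sub-increment is at most \<open>K * u\<close>, so
      the cut-off at \<open>y / 2 ^ m\<close> changes nothing there, while off \<open>A\<close>
      nonnegativity suffices. Thus the indicator of \<open>A\<close>, which may depend on all
      increments, is gone before independence is used.\<close>
    define g where "g x = exp (l * x) * indicator {..y / 2 ^ m} (l * x)" for x
    have [measurable]: "g \<in> borel_measurable borel" unfolding g_def by measurable
    have g_nonneg: "0 \<le> g x" for x by (simp add: g_def)
    have g_le: "g x \<le> exp (y / 2 ^ m)" for x by (auto simp: g_def split: split_indicator)
    have int_g: "integrable M (\<lambda>\<omega>. g (?d j \<omega>))" if "j \<in> I" for j
      using that g_nonneg g_le by (intro integrable_const_bound[of _ "exp (y / 2 ^ m)"]) auto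
    have ind_g: "indep_vars (\<lambda>_. borel) (\<lambda>j \<omega>. g (?d j \<omega>)) I"
      by (rule indep_vars_compose2[OF ind]) measurable
    have fin: "finite I" by (simp add: I_def)
    have "AE \<omega> in M. \<forall>j\<in>I. \<omega> \<in> A \<longrightarrow> ?d j \<omega> \<le> K * u"
      unfolding AE_finite_all[OF fin] using le[OF I_lt] by (auto simp: u_def)
    then have "AE \<omega> in M. exp (l * ?D i \<omega>) * indicator A \<omega> \<le> (\<Prod>j\<in>I. g (?d j \<omega>))"
    proof (rule eventually_mono)
      fix \<omega> assume *: "\<forall>j\<in>I. \<omega> \<in> A \<longrightarrow> ?d j \<omega> \<le> K * u"
      show "exp (l * ?D i \<omega>) * indicator A \<omega> \<le> (\<Prod>j\<in>I. g (?d j \<omega>))"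
      proof (cases "\<omega> \<in> A")
        case True
        have "l * ?d j \<omega> \<le> y / 2 ^ m" if "j \<in> I" for j
        proof -
          have "l * ?d j \<omega> \<le> l * (K * u)" using * that True \<open>0 < l\<close> by (intro mult_left_mono) auto
          then show ?thesis by (simp add: y_def u_def power_add)
        qed
        then have "(\<Prod>j\<in>I. g (?d j \<omega>)) = (\<Prod>j\<in>I. exp (l * ?d j \<omega>))"
          by (intro prod.cong) (auto simp: g_def)
        also have "\<dots> = exp (l * ?D i \<omega>)"
          unfolding D_sum sum_distrib_left using fin by (rule exp_sum[symmetric])
        finally show ?thesis using True by simp
      next
        case False
        then show ?thesis using g_nonneg by (simp add: prod_nonneg)
      qed
    qed
    then have "?E \<le> expectation (\<lambda>\<omega>. \<Prod>j\<in>I. g (?d j \<omega>))"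
    proof (rule integral_mono_AE'[rotated])
      show "integrable M (\<lambda>\<omega>. \<Prod>j\<in>I. g (?d j \<omega>))"
        using int_g by (intro indep_vars_integrable[OF fin ind_g])
    qed (simp add: g_nonneg prod_nonneg)
    also have "\<dots> = (\<Prod>j\<in>I. expectation (\<lambda>\<omega>. g (?d j \<omega>)))"
      using int_g by (intro indep_vars_lebesgue_integral[OF fin ind_g])
    also have "\<dots> \<le> (\<Prod>j\<in>I. 1 + (1 - c) * (exp (y / 2 ^ m) - 1))"
    proof (rule prod_mono, intro conjI)
      fix j assume j: "j \<in> I"
      show "0 \<le> expectation (\<lambda>\<omega>. g (?d j \<omega>))" by (simp add: g_nonneg)
      have [measurable]: "X u \<in> borel_measurable M" using u by (intro X_measurable) auto
      have diff: "real (Suc j) * u - real j * u = u" by (simp add: of_nat_Suc algebra_simps)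
      have "distr M borel (?d j) = distr M borel (X u)"
        using distr_increment[of "real j * u" "real (Suc j) * u"] tm[of j] tm[of "Suc j"] I_lt[OF j] u
        by (simp add: diff mult_right_mono)
      then have "integral\<^sup>L (distr M borel (?d j)) g = integral\<^sup>L (distr M borel (X u)) g" by simp
      then have "expectation (\<lambda>\<omega>. g (?d j \<omega>)) = expectation (\<lambda>\<omega>. g (X u \<omega>))"
        using j by (simp add: integral_distr)
      also have "\<dots> \<le> 1 + (1 - c) * (exp (y / 2 ^ m) - 1)"
        unfolding g_def using u y \<open>0 < l\<close> by (intro expectation_exp_truncated_le) auto
      finally show "expectation (\<lambda>\<omega>. g (?d j \<omega>)) \<le> 1 + (1 - c) * (exp (y / 2 ^ m) - 1)" .
    qed
    also have "\<dots> = (1 + (1 - c) * (exp (y / 2 ^ m) - 1)) ^ 2 ^ m"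
      by (simp add: card_I)
    \<comment> \<open>\<open>exp_le_quadratic\<close> requires \<open>y / 2 ^ m \<le> 1\<close>,
      which is the condition on \<open>m\<close>; then 1 + x \<le> exp x.\<close>
    also have "\<dots> \<le> exp ((1 - c) * ((y / 2 ^ m) * (1 + y / 2 ^ m))) ^ 2 ^ m"
    proof (rule power_mono)
      have "exp (y / 2 ^ m) - 1 \<le> (y / 2 ^ m) * (1 + y / 2 ^ m)"
        using exp_le_quadratic[of "y / 2 ^ m"] y m by simp
      then have "1 + (1 - c) * (exp (y / 2 ^ m) - 1) \<le> 1 + (1 - c) * ((y / 2 ^ m) * (1 + y / 2 ^ m))"
        using c_le_1 by (intro add_left_mono mult_left_mono) auto
      then show "1 + (1 - c) * (exp (y / 2 ^ m) - 1) \<le> exp ((1 - c) * ((y / 2 ^ m) * (1 + y / 2 ^ m)))"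
        using exp_ge_add_one_self order_trans by blast
      show "0 \<le> 1 + (1 - c) * (exp (y / 2 ^ m) - 1)"
        using c_le_1 y by (intro add_nonneg_nonneg mult_nonneg_nonneg) auto
    qed
    also have "\<dots> = exp ((1 - c) * y * (1 + y / 2 ^ m))"
      by (simp flip: exp_of_nat_mult)
    finally show ?thesis .
  qed
  have "(\<lambda>m. exp ((1 - c) * y * (1 + y / 2 ^ m))) \<longlonglongrightarrow> exp ((1 - c) * y * (1 + 0))"
    by (intro tendsto_intros LIMSEQ_divide_realpow_zero) auto
  moreover have "eventually (\<lambda>m. ?E \<le> exp ((1 - c) * y * (1 + y / 2 ^ m))) sequentially"
  proof -
    obtain m0 where m0: "y \<le> 2 ^ m0" using real_arch_pow[of 2 y] by (auto intro: less_imp_le)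
    show ?thesis
    proof (rule eventually_sequentiallyI[of m0])
      fix m assume "m0 \<le> m"
      then have "y \<le> 2 ^ m" using m0 by (meson order_trans power_increasing one_le_numeral)
      then show "?E \<le> exp ((1 - c) * y * (1 + y / 2 ^ m))" by (rule bound)
    qed
  qed
  ultimately have "?E \<le> exp ((1 - c) * y * (1 + 0))"
    by (intro tendsto_lowerbound[of _ _ sequentially]) auto
  then show ?thesis by (simp add: y_def)
qed

text \<open>Chernoff bound: exceeding the new constant by \<open>e\<close> on \<open>A\<close> has
  probability at most \<open>exp (- l * e)\<close> for every \<open>l > 0\<close>, because the
  exponential moment grows only like \<open>exp (l * b)\<close>. Letting \<open>l\<close> grow makes
  the event null.\<close>

lemma improve_dyadic_bound:
  assumes s: "0 < s" "s \<le> T" and A: "A \<in> events" and "0 \<le> K"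
    and le: "\<And>k i. i < 2 ^ k \<Longrightarrow> AE \<omega> in M. \<omega> \<in> A \<longrightarrow> dyadic_increment s k i \<omega> \<le> K * (s / 2 ^ k)"
    and i: "i < 2 ^ k"
  shows "AE \<omega> in M. \<omega> \<in> A \<longrightarrow> dyadic_increment s k i \<omega> \<le> (1 - c) * K * (s / 2 ^ k)"
proof -
  define D where "D = dyadic_increment s k i"
  define b where "b = (1 - c) * K * (s / 2 ^ k)"
  have [measurable]: "D \<in> borel_measurable M"
    unfolding D_def using dyadic_time_le[OF s, of "Suc i" k] dyadic_time_le[OF s, of i k] i s
    by (intro borel_measurable_diff X_measurable) auto
  note [measurable] = A
  have leD: "AE \<omega> in M. \<omega> \<in> A \<longrightarrow> D \<omega> \<le> K * (s / 2 ^ k)"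
    unfolding D_def by (rule le[OF i])
  \<comment> \<open>The decay in \<open>l\<close> needs a positive margin, so the margins
    \<open>1 / Suc n\<close> are treated one by one and then intersected.\<close>
  have "AE \<omega> in M. \<forall>n::nat. \<omega> \<in> A \<longrightarrow> D \<omega> < b + 1 / Suc n"
    unfolding AE_all_countable
  proof
    fix n :: nat
    define e :: real where "e = 1 / Suc n"
    have e: "0 < e" by (simp add: e_def)
    let ?B = "{\<omega> \<in> space M. \<omega> \<in> A \<and> b + e \<le> D \<omega>}"
    have B_ev: "?B \<in> events" by measurable
    have B_sp: "?B \<inter> space M = ?B" by auto
    have B: "prob ?B \<le> exp (- l * e)" if l: "0 < l" for l
    proof -
      have int: "integrable M (\<lambda>\<omega>. exp (l * D \<omega>) * indicator A \<omega>)"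
      proof (rule integrable_const_bound[of _ "exp (l * (K * (s / 2 ^ k)))"])
        show "AE \<omega> in M. norm (exp (l * D \<omega>) * indicator A \<omega>) \<le> exp (l * (K * (s / 2 ^ k)))"
          using leD
        proof (rule eventually_mono)
          fix \<omega> assume *: "\<omega> \<in> A \<longrightarrow> D \<omega> \<le> K * (s / 2 ^ k)"
          have "l * D \<omega> \<le> l * (K * (s / 2 ^ k))" if "\<omega> \<in> A"
            using * l that by (intro mult_left_mono) auto
          then show "norm (exp (l * D \<omega>) * indicator A \<omega>) \<le> exp (l * (K * (s / 2 ^ k)))"
            by (auto split: split_indicator)
        qed
      qed measurable
      have "exp (l * (b + e)) * prob ?B = expectation (\<lambda>\<omega>. exp (l * (b + e)) * indicator ?B \<omega>)"
        by (simp add: B_sp)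
      also have "\<dots> \<le> expectation (\<lambda>\<omega>. exp (l * D \<omega>) * indicator A \<omega>)"
      proof (rule integral_mono[OF _ int])
        show "integrable M (\<lambda>\<omega>. exp (l * (b + e)) * indicator ?B \<omega>)"
          using B_ev by (intro integrable_mult_right) (simp add: integrable_indicator_iff B_sp emeasure_eq_measure)
        fix \<omega> assume "\<omega> \<in> space M"
        then show "exp (l * (b + e)) * indicator ?B \<omega> \<le> exp (l * D \<omega>) * indicator A \<omega>"
          using l by (auto split: split_indicator)
      qed
      also have "\<dots> \<le> exp ((1 - c) * (l * K * (s / 2 ^ k)))"
        unfolding D_def by (rule expectation_exp_dyadic_le[OF s A l \<open>0 \<le> K\<close> le i])
      also have "\<dots> = exp (l * b)" by (simp add: b_def mult_ac)
      also have "\<dots> = exp (l * (b + e)) * exp (- l * e)"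
        by (simp add: distrib_left flip: exp_add)
      finally show ?thesis by simp
    qed
    have "(\<lambda>n. (exp (- e)) ^ n) \<longlonglongrightarrow> 0"
      using e by (intro LIMSEQ_realpow_zero) auto
    moreover have "prob ?B \<le> exp (- e) ^ n" if "n \<ge> 1" for n
      using B[of "real n"] that by (simp add: mult.commute flip: exp_of_nat_mult)
    ultimately have "prob ?B \<le> 0"
      by (intro tendsto_lowerbound[of "\<lambda>n. exp (- e) ^ n" _ sequentially])
         (auto intro: eventually_sequentiallyI[of 1])
    then have "prob ?B = 0" using measure_nonneg[of M ?B] by linarith
    then have "AE \<omega> in M. \<omega> \<notin> ?B"
      using B_ev by (subst AE_iff_measurable[of ?B]) (auto simp: emeasure_eq_measure)
    then show "AE \<omega> in M. \<omega> \<in> A \<longrightarrow> D \<omega> < b + 1 / Suc n"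
      by (rule AE_mp) (auto simp: e_def)
  qed
  then have "AE \<omega> in M. \<omega> \<in> A \<longrightarrow> D \<omega> \<le> (1 - c) * K * (s / 2 ^ k)"
  proof (rule eventually_mono)
    fix \<omega> assume *: "\<forall>n::nat. \<omega> \<in> A \<longrightarrow> D \<omega> < b + 1 / Suc n"
    show "\<omega> \<in> A \<longrightarrow> D \<omega> \<le> (1 - c) * K * (s / 2 ^ k)"
    proof
      assume "\<omega> \<in> A"
      show "D \<omega> \<le> (1 - c) * K * (s / 2 ^ k)"
      proof (rule ccontr)
        assume "\<not> ?thesis"
        then obtain n where "1 / Suc n < D \<omega> - b"
          using reals_Archimedean[of "D \<omega> - b"] by (auto simp: b_def inverse_eq_divide)
        then show False using * \<open>\<omega> \<in> A\<close> by (smt (verit))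
      qed
    qed
  qed
  then show ?thesis unfolding D_def .
qed

text \<open>Each improvement uses the bound at all finer levels, so the induction carries all
  \<open>k\<close> and \<open>i\<close>. After \<open>n\<close> rounds the constant is
  \<open>(1 - c) ^ n * K\<close>; hence \<open>X s \<le> 0\<close> almost surely on
  \<open>A\<close>, whereas \<open>X s > 0\<close> has probability at least
  \<open>c\<close>.\<close>

lemma prob_le_of_dyadic_bound:
  assumes s: "0 < s" "s \<le> T" and A: "A \<in> events" and "0 \<le> K"
    and le: "\<And>k i. i < 2 ^ k \<Longrightarrow> AE \<omega> in M. \<omega> \<in> A \<longrightarrow> dyadic_increment s k i \<omega> \<le> K * (s / 2 ^ k)"
  shows "prob A \<le> 1 - c"
proof -
  have "i < 2 ^ k \<Longrightarrow> AE \<omega> in M. \<omega> \<in> A \<longrightarrow> dyadic_increment s k i \<omega> \<le> (1 - c) ^ n * K * (s / 2 ^ k)"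
    for n k i
  proof (induction n arbitrary: k i)
    case 0
    then show ?case using le by simp
  next
    case (Suc n)
    have "0 \<le> (1 - c) ^ n * K" using c_le_1 \<open>0 \<le> K\<close> by simp
    from improve_dyadic_bound[OF s A this Suc.IH Suc.prems] show ?case by (simp add: mult_ac)
  qed
  \<comment> \<open>Level 0 has a single increment, from 0 to \<open>s\<close>.\<close>
  from this[of 0 0] have "AE \<omega> in M. \<forall>n. \<omega> \<in> A \<longrightarrow> X s \<omega> - X 0 \<omega> \<le> (1 - c) ^ n * K * s"
    unfolding AE_all_countable by simp
  then have "AE \<omega> in M. \<omega> \<in> A \<longrightarrow> \<not> X s \<omega> > 0"
  proof (rule AE_mp, intro AE_I2 impI)
    fix \<omega> assume \<omega>: "\<omega> \<in> space M" "\<omega> \<in> A" and *: "\<forall>n. \<omega> \<in> A \<longrightarrow> X s \<omega> - X 0 \<omega> \<le> (1 - c) ^ n * K * s"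
    have "(\<lambda>n. (1 - c) ^ n * K * s) \<longlonglongrightarrow> 0 * K * s"
      using c_pos c_le_1 by (intro tendsto_intros LIMSEQ_realpow_zero) auto
    then have "X s \<omega> \<le> 0 * K * s"
      using * \<omega> X_0[OF \<omega>(1)] by (intro tendsto_lowerbound[of _ _ sequentially]) auto
    then show "\<not> X s \<omega> > 0" by simp
  qed
  moreover have [measurable]: "X s \<in> borel_measurable M" using s by (intro X_measurable) auto
  note A[measurable]
  ultimately have "prob A \<le> prob {\<omega> \<in> space M. \<not> X s \<omega> > 0}"
    by (intro finite_measure_mono_AE) auto
  also have "\<dots> = 1 - prob {\<omega> \<in> space M. X s \<omega> > 0}"
    by (rule prob_neg) measurable
  also have "\<dots> \<le> 1 - c" using charge_pos[of s] s by simp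
  finally show ?thesis .
qed

end

section \<open>From steep small steps to full support\<close>

context two_sided_levy
begin

text \<open>Right-continuity at 0: each path stays within \<open>a / 2\<close> of 0 on some initial
  interval, so the events for the shrinking horizons \<open>T / 2 ^ j\<close> increase to the whole
  space.\<close>

lemma dyadic_increments_small:
  assumes "0 < a"
  obtains J A where "A \<in> events" "1 - c < prob A"
    "\<And>\<omega> k i. \<omega> \<in> A \<Longrightarrow> i < 2 ^ k \<Longrightarrow> dyadic_increment (T / 2 ^ J) k i \<omega> < a"
proof -
  \<comment> \<open>Restricting to dyadic times makes the event a countable intersection;
    \<open>a / 2\<close> leaves room for differences of two values.\<close>
  define A where "A j = {\<omega> \<in> space M. \<forall>k. \<forall>i\<in>{..2 ^ k}. \<bar>X (real i * (T / 2 ^ j / 2 ^ k)) \<omega>\<bar> < a / 2}"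
    for j :: nat
  have T2: "T / 2 ^ j \<le> T" for j :: nat
    using T_pos by (simp add: divide_le_eq)
  have tm: "real i * (T / 2 ^ j / 2 ^ k) \<in> {0..T}" if "i \<le> 2 ^ k" for i j k :: nat
    using dyadic_time_le[of "T / 2 ^ j" i k] T2[of j] T_pos that by auto
  have A_ev: "A j \<in> events" for j
    unfolding A_def
  proof (intro sets.sets_Collect_countable_All sets.sets_Collect_finite_All)
    fix k i :: nat assume "i \<in> {..2 ^ k}"
    then have [measurable]: "X (real i * (T / 2 ^ j / 2 ^ k)) \<in> borel_measurable M"
      by (intro X_measurable tm) auto
    show "{\<omega> \<in> space M. \<bar>X (real i * (T / 2 ^ j / 2 ^ k)) \<omega>\<bar> < a / 2} \<in> events" by measurable
  qed simp
  have "incseq A"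
  proof (rule incseq_SucI, rule subsetI)
    fix j \<omega> assume \<omega>: "\<omega> \<in> A j"
    show "\<omega> \<in> A (Suc j)"
      unfolding A_def
    proof (intro CollectI conjI allI ballI)
      show "\<omega> \<in> space M" using \<omega> by (simp add: A_def)
      fix k i :: nat assume "i \<in> {..2 ^ k}"
      then have "i \<in> {..2 ^ Suc k}" by auto
      then have "\<bar>X (real i * (T / 2 ^ j / 2 ^ Suc k)) \<omega>\<bar> < a / 2"
        using \<omega> unfolding A_def by blast
      then show "\<bar>X (real i * (T / 2 ^ Suc j / 2 ^ k)) \<omega>\<bar> < a / 2" by (simp add: mult_ac)
    qed
  qed
  then have "(\<lambda>j. prob (A j)) \<longlonglongrightarrow> prob (\<Union>j. A j)"
    using A_ev by (intro finite_Lim_measure_incseq) auto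
  moreover have "(\<Union>j. A j) = space M"
  proof
    show "space M \<subseteq> (\<Union>j. A j)"
    proof
      fix \<omega> assume \<omega>: "\<omega> \<in> space M"
      obtain d where d: "0 < d" "\<And>t. 0 \<le> t \<Longrightarrow> t < d \<Longrightarrow> t \<le> T \<Longrightarrow> \<bar>X t \<omega>\<bar> < a / 2"
        using X_right_continuous_0[OF \<omega>, of "a / 2"] \<open>0 < a\<close> by auto
      obtain j :: nat where "T / d < 2 ^ j" using real_arch_pow[of 2 "T / d"] by auto
      then have j: "T / 2 ^ j < d" using d(1) by (simp add: field_simps)
      have "\<bar>X (real i * (T / 2 ^ j / 2 ^ k)) \<omega>\<bar> < a / 2" if "i \<le> 2 ^ k" for k i :: nat
      proof (rule d(2))
        have "real i \<le> real (2 ^ k)" using that by (simp only: of_nat_le_iff)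
        then have "real i * (T / 2 ^ j / 2 ^ k) \<le> 2 ^ k * (T / 2 ^ j / 2 ^ k)"
          using T_pos by (intro mult_right_mono) auto
        then show "real i * (T / 2 ^ j / 2 ^ k) < d" using j by simp
      qed (use tm[OF that] in auto)
      then show "\<omega> \<in> (\<Union>j. A j)" using \<omega> by (auto simp: A_def)
    qed
  qed (auto simp: A_def)
  ultimately have "(\<lambda>j. prob (A j)) \<longlonglongrightarrow> 1" by (simp add: prob_space)
  then have "eventually (\<lambda>j. 1 - c < prob (A j)) sequentially"
    using c_pos by (intro order_tendstoD) auto
  then obtain J where J: "1 - c < prob (A J)"
    using eventually_happens by fastforce
  show ?thesis
  proof (rule that[OF A_ev J])
    fix \<omega> and k i :: nat assume \<omega>: "\<omega> \<in> A J" and i: "i < 2 ^ k"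
    then have "\<bar>X (real (Suc i) * (T / 2 ^ J / 2 ^ k)) \<omega>\<bar> < a / 2"
      "\<bar>X (real i * (T / 2 ^ J / 2 ^ k)) \<omega>\<bar> < a / 2"
      unfolding A_def by (auto simp del: of_nat_Suc)
    then show "dyadic_increment (T / 2 ^ J) k i \<omega> < a" by linarith
  qed
qed

text \<open>Otherwise stationarity makes all dyadic increments avoid the windows; being below
  \<open>a\<close> on a large event, they would obey the linear bound excluded by
  \<open>prob_le_of_dyadic_bound\<close>. Steps that are small yet steep can reach a target ahead of
  time.\<close>

lemma charge_steep:
  assumes "0 < a" "0 \<le> K"
  shows "\<exists>j. prob {\<omega> \<in> space M. K * (T / 2 ^ j) < X (T / 2 ^ j) \<omega> \<and> X (T / 2 ^ j) \<omega> < a} > 0"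
proof (rule ccontr)
  assume "\<not> ?thesis"
  then have no: "prob {\<omega> \<in> space M. K * (T / 2 ^ j) < X (T / 2 ^ j) \<omega> \<and> X (T / 2 ^ j) \<omega> < a} = 0" for j
    by (simp add: zero_less_measure_iff)
  obtain J A where A: "A \<in> events" "1 - c < prob A"
    and small: "\<And>\<omega> k i. \<omega> \<in> A \<Longrightarrow> i < 2 ^ k \<Longrightarrow> dyadic_increment (T / 2 ^ J) k i \<omega> < a"
    using dyadic_increments_small[OF \<open>0 < a\<close>] by metis
  define s where "s = T / 2 ^ J"
  have s: "0 < s" "s \<le> T" using T_pos by (auto simp: s_def divide_le_eq)
  have "prob A \<le> 1 - c"
  proof (rule prob_le_of_dyadic_bound[OF s A(1) \<open>0 \<le> K\<close>])
    fix k i :: nat assume i: "i < 2 ^ k"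
    define u where "u = s / 2 ^ k"
    have u: "0 < u" "u \<le> T" using s dyadic_time_le[OF s, of 1 k] by (auto simp: u_def)
    have tm: "real (Suc i) * u \<le> T" using dyadic_time_le[OF s, of "Suc i" k] i by (simp add: u_def)
    have uj: "u = T / 2 ^ (J + k)" by (simp add: u_def s_def power_add)
    have diff: "real (Suc i) * u - real i * u = u" by (simp add: algebra_simps)
    have le: "real i * u \<le> real (Suc i) * u" using u by (intro mult_right_mono) auto
    let ?D = "\<lambda>\<omega>. X (real (Suc i) * u) \<omega> - X (real i * u) \<omega>"
    have [measurable]: "X (real (Suc i) * u) \<in> borel_measurable M" "X (real i * u) \<in> borel_measurable M"
      using u tm order_trans[OF le tm] by (auto intro!: X_measurable simp del: of_nat_Suc)
    have "prob {\<omega> \<in> space M. ?D \<omega> \<in> {K * u<..<a}} = prob {\<omega> \<in> space M. X u \<omega> \<in> {K * u<..<a}}"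
      using prob_increment[of "real i * u" "real (Suc i) * u" "{K * u<..<a}"] u tm le
      unfolding diff by (simp del: of_nat_Suc)
    also have "\<dots> = 0" using no[of "J + k"] unfolding uj by simp
    finally have "AE \<omega> in M. \<omega> \<notin> {\<omega> \<in> space M. ?D \<omega> \<in> {K * u<..<a}}"
      by (subst AE_iff_measurable[of "{\<omega> \<in> space M. ?D \<omega> \<in> {K * u<..<a}}"])
         (auto simp: emeasure_eq_measure simp del: of_nat_Suc)
    then have "AE \<omega> in M. \<omega> \<in> A \<longrightarrow> ?D \<omega> \<le> K * u"
    proof (rule AE_mp, intro AE_I2 impI)
      fix \<omega> assume "\<omega> \<in> space M" "\<omega> \<notin> {\<omega> \<in> space M. ?D \<omega> \<in> {K * u<..<a}}" "\<omega> \<in> A"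
      moreover have "?D \<omega> < a" using small[OF \<open>\<omega> \<in> A\<close> i] unfolding u_def s_def .
      ultimately show "?D \<omega> \<le> K * u" by (auto simp del: of_nat_Suc)
    qed
    then show "AE \<omega> in M. \<omega> \<in> A \<longrightarrow> dyadic_increment s k i \<omega> \<le> K * (s / 2 ^ k)"
      unfolding u_def .
  qed
  with A(2) show False by simp
qed

text \<open>Lindelof argument: were no point of the interval in the support, countably many null
  intervals with rational ends would cover it.\<close>

lemma exists_support_point:
  fixes Y :: "'a \<Rightarrow> real"
  assumes [measurable]: "Y \<in> borel_measurable M"
    and pos: "0 < prob {\<omega> \<in> space M. l < Y \<omega> \<and> Y \<omega> < h}"
  shows "\<exists>y. l < y \<and> y < h \<and> (\<forall>e>0. 0 < prob {\<omega> \<in> space M. \<bar>Y \<omega> - y\<bar> < e})"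
proof (rule ccontr)
  assume neg: "\<not> ?thesis"
  let ?N = "\<lambda>p q :: rat. {\<omega> \<in> space M. of_rat p < Y \<omega> \<and> Y \<omega> < of_rat q}"
  define S where "S = {(p, q). prob (?N p q) = 0}"
  have "AE \<omega> in M. \<forall>z\<in>S. \<omega> \<notin> ?N (fst z) (snd z)"
  proof (subst AE_ball_countable)
    show "\<forall>z\<in>S. AE \<omega> in M. \<omega> \<notin> ?N (fst z) (snd z)"
    proof
      fix z assume "z \<in> S"
      then show "AE \<omega> in M. \<omega> \<notin> ?N (fst z) (snd z)"
        by (subst AE_iff_measurable[of "?N (fst z) (snd z)"])
           (auto simp: emeasure_eq_measure S_def)
    qed
  qed simp
  then have "AE \<omega> in M. \<omega> \<notin> {\<omega> \<in> space M. l < Y \<omega> \<and> Y \<omega> < h}"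
  proof (rule AE_mp, intro AE_I2 impI notI)
    fix \<omega> assume *: "\<forall>z\<in>S. \<omega> \<notin> ?N (fst z) (snd z)" and \<omega>: "\<omega> \<in> {\<omega> \<in> space M. l < Y \<omega> \<and> Y \<omega> < h}"
    then obtain e where e: "0 < e" "\<not> 0 < prob {\<omega>' \<in> space M. \<bar>Y \<omega>' - Y \<omega>\<bar> < e}"
      using neg by blast
    obtain p where p: "Y \<omega> - e < of_rat p" "of_rat p < Y \<omega>"
      using of_rat_dense[of "Y \<omega> - e" "Y \<omega>"] e by auto
    obtain q where q: "Y \<omega> < of_rat q" "of_rat q < Y \<omega> + e"
      using of_rat_dense[of "Y \<omega>" "Y \<omega> + e"] e by auto
    have "prob (?N p q) \<le> prob {\<omega>' \<in> space M. \<bar>Y \<omega>' - Y \<omega>\<bar> < e}"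
      using p q by (intro finite_measure_mono) (auto simp: abs_less_iff)
    then have "(p, q) \<in> S" using e(2) by (simp add: S_def zero_less_measure_iff measure_le_0_iff)
    then show False using * \<omega> p q by auto
  qed
  then have "prob {\<omega> \<in> space M. l < Y \<omega> \<and> Y \<omega> < h} = 0"
    by (subst (asm) AE_iff_measurable[of "{\<omega> \<in> space M. l < Y \<omega> \<and> Y \<omega> < h}"])
       (auto simp: emeasure_eq_measure)
  with pos show False by simp
qed

text \<open>A small step \<open>y < e / 2\<close> in the support of \<open>X u\<close> is repeated
  \<open>m\<close> times, with \<open>m\<close> the integer part of \<open>x / y\<close>. The path
  is then near \<open>m * y\<close>, which is within \<open>e / 2\<close> of \<open>x\<close>, and
  it spends the time left until \<open>s\<close> near there.\<close>

lemma charge_nonneg_point: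
  assumes s: "0 < s" "s \<le> T" and "0 \<le> x" "0 < e"
  shows "0 < prob {\<omega> \<in> space M. \<bar>X s \<omega> - x\<bar> < e}"
proof (cases "x = 0")
  case True
  then show ?thesis using charge_near_0[of s e] s \<open>0 < e\<close> by simp
next
  case False
  then have x: "0 < x" using \<open>0 \<le> x\<close> by simp
  \<comment> \<open>This slope makes the steps fit: \<open>m * u * K \<le> m * y \<le> x\<close>
    gives \<open>m * u \<le> s / 2\<close>, so the last increment has a positive duration.\<close>
  define K where "K = 2 * x / s"
  have K: "0 < K" using x s by (simp add: K_def)
  obtain j where j: "prob {\<omega> \<in> space M. K * (T / 2 ^ j) < X (T / 2 ^ j) \<omega> \<and> X (T / 2 ^ j) \<omega> < e / 2} > 0"
    using charge_steep[of "e / 2" K] \<open>0 < e\<close> K by auto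
  define u where "u = T / 2 ^ j"
  have u: "0 < u" "u \<le> T" using T_pos by (auto simp: u_def divide_le_eq)
  have [measurable]: "X u \<in> borel_measurable M" using u by (intro X_measurable) auto
  obtain y where y: "K * u < y" "y < e / 2" "\<And>d. 0 < d \<Longrightarrow> 0 < prob {\<omega> \<in> space M. \<bar>X u \<omega> - y\<bar> < d}"
    using exists_support_point[of "X u" "K * u" "e / 2"] j unfolding u_def[symmetric] by auto
  have y0: "0 < y" using y(1) K u by (smt (verit) mult_pos_pos)
  define m where "m = nat \<lfloor>x / y\<rfloor>"
  have m: "real m * y \<le> x" "x < real m * y + y"
  proof -
    have "real m = of_int \<lfloor>x / y\<rfloor>" unfolding m_def using x y0 by simp
    then have "real m \<le> x / y" "x / y < real m + 1" by linarith+
    then show "real m * y \<le> x" "x < real m * y + y" using y0 by (simp_all add: field_simps)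
  qed
  have mu: "real m * u < s"
  proof -
    have "real m * u * K \<le> real m * y" using mult_left_mono[of "K * u" y "real m"] y(1) by (simp add: mult_ac)
    also have "\<dots> \<le> x" by (rule m)
    finally have "real m * u \<le> s / 2" using x s by (simp add: K_def field_simps)
    then show ?thesis using s by simp
  qed
  \<comment> \<open>The \<open>m + 1\<close> increments err by less than \<open>d\<close> each,
    together by at most \<open>e / 2\<close>; the other half of \<open>e\<close> covers
    \<open>x - m * y < y\<close>.\<close>
  define d where "d = e / (2 * (real m + 1))"
  have d: "0 < d" using \<open>0 < e\<close> by (simp add: d_def)
  define t where "t i = (if i \<le> m then real i * u else s)" for i
  let ?D = "\<lambda>i \<omega>. X (t (Suc i)) \<omega> - X (t i) \<omega>"
  define B where "B i = {r. \<bar>r - (if i < m then y else 0)\<bar> < d}" for i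
  have [measurable]: "B i \<in> sets borel" for i unfolding B_def by measurable
  have t_le: "t i \<le> t (Suc i)" "t i < t (Suc i)" if "i < Suc m" for i
    using that u mu by (cases "i = m"; simp add: t_def)+
  have t_mem: "0 \<le> t i" "t i \<le> T" if "i \<le> Suc m" for i
  proof -
    show "0 \<le> t i" using u s by (simp add: t_def)
    have "real i * u \<le> real m * u" if "i \<le> m" using that u by (intro mult_right_mono) auto
    then show "t i \<le> T" using mu s by (auto simp: t_def)
  qed
  have ind: "indep_vars (\<lambda>_. borel) ?D {..<Suc m}"
    using t_le t_mem by (intro indep_increments) auto
  have "prob (\<Inter>i\<in>{..<Suc m}. ?D i -` B i \<inter> space M) = (\<Prod>i\<in>{..<Suc m}. prob (?D i -` B i \<inter> space M))"
    by (rule indep_varsD[OF ind]) auto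
  also have "\<dots> > 0"
  proof (rule prod_pos)
    fix i assume i: "i \<in> {..<Suc m}"
    have "?D i -` B i \<inter> space M = {\<omega> \<in> space M. ?D i \<omega> \<in> B i}" by auto
    then have eq: "prob (?D i -` B i \<inter> space M) = prob {\<omega> \<in> space M. X (t (Suc i) - t i) \<omega> \<in> B i}"
      using prob_increment[of "t i" "t (Suc i)" "B i"] t_le[of i] t_mem[of i] t_mem[of "Suc i"] i by simp
    show "0 < prob (?D i -` B i \<inter> space M)"
    proof (cases "i < m")
      case True
      then have "t (Suc i) - t i = u" by (simp add: t_def algebra_simps)
      then show ?thesis unfolding eq using True y(3)[OF d] by (simp add: B_def)
    next
      case False
      then have "t (Suc i) - t i = s - real m * u" using i by (simp add: t_def less_Suc_eq)
      moreover have "s - real m * u \<in> {0<..T}" using mu s u by (auto intro: order_trans[of _ s])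
      ultimately show ?thesis unfolding eq using False charge_near_0[OF _ d] by (simp add: B_def)
    qed
  qed
  also have "prob (\<Inter>i\<in>{..<Suc m}. ?D i -` B i \<inter> space M) \<le> prob {\<omega> \<in> space M. \<bar>X s \<omega> - x\<bar> < e}"
  proof (rule finite_measure_mono)
    have [measurable]: "X s \<in> borel_measurable M" using s by (intro X_measurable) auto
    show "{\<omega> \<in> space M. \<bar>X s \<omega> - x\<bar> < e} \<in> events" by measurable
    show "(\<Inter>i\<in>{..<Suc m}. ?D i -` B i \<inter> space M) \<subseteq> {\<omega> \<in> space M. \<bar>X s \<omega> - x\<bar> < e}"
    proof
      fix \<omega> assume *: "\<omega> \<in> (\<Inter>i\<in>{..<Suc m}. ?D i -` B i \<inter> space M)"
      have **: "\<omega> \<in> ?D i -` B i \<inter> space M" if "i < Suc m" for i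
        using INT_D[OF *, of i] that by blast
      have \<omega>: "\<omega> \<in> space M" using **[of 0] by simp
      have D: "?D i \<omega> \<in> B i" if "i < Suc m" for i using **[OF that] by simp
      have "(\<Sum>i<Suc m. ?D i \<omega>) = X (t (Suc m)) \<omega> - X (t 0) \<omega>"
        by (rule sum_lessThan_telescope)
      then have sum: "(\<Sum>i<Suc m. ?D i \<omega>) = X s \<omega>" using X_0[OF \<omega>] by (simp add: t_def)
      have ysum: "(\<Sum>i<Suc m. if i < m then y else 0) = real m * y" by simp
      have "X s \<omega> - real m * y = (\<Sum>i<Suc m. ?D i \<omega>) - (\<Sum>i<Suc m. if i < m then y else 0)"
        by (simp only: sum ysum)
      also have "\<dots> = (\<Sum>i<Suc m. ?D i \<omega> - (if i < m then y else 0))"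
        by (rule sum_subtractf[symmetric])
      also have "\<bar>\<dots>\<bar> \<le> (\<Sum>i<Suc m. \<bar>?D i \<omega> - (if i < m then y else 0)\<bar>)" by (rule sum_abs)
      also have "\<dots> \<le> (\<Sum>i<Suc m. d)"
      proof (rule sum_mono)
        fix i assume "i \<in> {..<Suc m}"
        then show "\<bar>?D i \<omega> - (if i < m then y else 0)\<bar> \<le> d"
          using D[of i] by (simp add: B_def)
      qed
      also have "\<dots> = e / 2" by (simp add: d_def field_simps)
      finally have "\<bar>X s \<omega> - real m * y\<bar> \<le> e / 2" .
      then have "\<bar>X s \<omega> - x\<bar> < e" using m y(2) by linarith
      then show "\<omega> \<in> {\<omega> \<in> space M. \<bar>X s \<omega> - x\<bar> < e}" using \<omega> by simp
    qed
  qed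
  finally show ?thesis .
qed

lemma two_sided_levy_uminus: "two_sided_levy M T (\<lambda>t \<omega>. - X t \<omega>) c"
  by unfold_locales (use T_pos levy_process_uminus c_pos charge_pos charge_neg charge_near_0 in auto)

lemma full_support:
  assumes "0 < s" "s \<le> T" "0 < e"
  shows "0 < prob {\<omega> \<in> space M. \<bar>X s \<omega> - x\<bar> < e}"
proof (cases "0 \<le> x")
  case True
  then show ?thesis using charge_nonneg_point assms by blast
next
  case False
  interpret uminus: two_sided_levy M T "\<lambda>t \<omega>. - X t \<omega>" c by (rule two_sided_levy_uminus)
  have "0 < prob {\<omega> \<in> space M. \<bar>- X s \<omega> - - x\<bar> < e}"
    using False assms by (intro uminus.charge_nonneg_point) auto
  also have "{\<omega> \<in> space M. \<bar>- X s \<omega> - - x\<bar> < e} = {\<omega> \<in> space M. \<bar>X s \<omega> - x\<bar> < e}"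
    by (auto simp: abs_minus_commute)
  finally show ?thesis .
qed

end

subsection \<open>Consequences of the lower bounds on the mass near 0\<close>

lemma lower_massD:
  assumes "lower_mass e \<mu>"
  obtains \<kappa> d\<^sub>0 where "0 < \<kappa>" "0 < d\<^sub>0"
    "\<And>d. 0 < d \<Longrightarrow> d < d\<^sub>0 \<Longrightarrow> ennreal (\<kappa> * d powr e) \<le> emeasure \<mu> {-d..d}"
proof -
  obtain k where k: "0 < k" "k < Liminf (at_right 0) (\<lambda>d. ennreal (d powr (- e)) * emeasure \<mu> {-d..d})"
    using assms dense unfolding lower_mass_def by blast
  then have "k < top" by (meson less_le_trans top_greatest)
  then obtain \<kappa> where \<kappa>: "k = ennreal \<kappa>" "0 \<le> \<kappa>" by (cases k) auto
  then have "0 < \<kappa>" using k(1) by simp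
  obtain d0 where d0: "0 < d0" "\<And>d. 0 < d \<Longrightarrow> d < d0 \<Longrightarrow> k < ennreal (d powr (- e)) * emeasure \<mu> {-d..d}"
    using less_LiminfD[OF k(2)] unfolding eventually_at_right_field by auto
  show ?thesis
  proof (rule that[OF \<open>0 < \<kappa>\<close> d0(1)])
    fix d :: real assume d: "0 < d" "d < d0"
    have "ennreal (d powr e) * k \<le> ennreal (d powr e) * (ennreal (d powr (- e)) * emeasure \<mu> {-d..d})"
      using d0(2)[OF d] by (intro mult_left_mono) auto
    also have "\<dots> = ennreal (d powr e * d powr (- e)) * emeasure \<mu> {-d..d}"
      by (simp add: ennreal_mult mult.assoc)
    also have "d powr e * d powr (- e) = 1" using d by (simp flip: powr_add)
    finally show "ennreal (\<kappa> * d powr e) \<le> emeasure \<mu> {-d..d}"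
      using \<kappa> by (simp add: ennreal_mult mult.commute)
  qed
qed

lemma lower_densityD:
  assumes "lower_density M T \<beta> X"
  shows "\<exists>r>0. \<exists>c>0. \<forall>a b s. - r \<le> a \<longrightarrow> a < b \<longrightarrow> b \<le> r \<longrightarrow> 0 < s \<longrightarrow> s \<le> T \<longrightarrow>
      c * (b - a) \<le> measure M {\<omega> \<in> space M. s powr (- 1 / \<beta>) * X s \<omega> \<in> {a<..<b}}"
proof -
  obtain r where r: "0 < r" and pos: "0 < (INF (a, b)\<in>{(a, b). - r \<le> a \<and> a < b \<and> b \<le> r}. INF s\<in>{0<..T}.
        ennreal (measure M {\<omega> \<in> space M. s powr (- 1 / \<beta>) * X s \<omega> \<in> {a<..<b}} / (b - a)))"
    (is "0 < ?I")
    using assms unfolding lower_density_def by blast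
  obtain k where k: "0 < k" "k < ?I" using dense[OF pos] by blast
  then have "k < top" by (meson less_le_trans top_greatest)
  then obtain c where c: "k = ennreal c" "0 \<le> c" by (cases k) auto
  then have "0 < c" using k(1) by simp
  show ?thesis
  proof (rule exI[of _ r], intro conjI r, rule exI[of _ c], intro conjI allI impI \<open>0 < c\<close>)
    fix a b s assume ab: "- r \<le> a" "a < b" "b \<le> r" and s: "0 < s" "s \<le> T"
    have "?I \<le> (INF s\<in>{0<..T}.
        ennreal (measure M {\<omega> \<in> space M. s powr (- 1 / \<beta>) * X s \<omega> \<in> {a<..<b}} / (b - a)))"
      using ab by (intro INF_lower2[of "(a, b)"]) auto
    also have "\<dots> \<le> ennreal (measure M {\<omega> \<in> space M. s powr (- 1 / \<beta>) * X s \<omega> \<in> {a<..<b}} / (b - a))"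
      using s by (intro INF_lower) auto
    finally have "ennreal c \<le> ennreal (measure M {\<omega> \<in> space M. s powr (- 1 / \<beta>) * X s \<omega> \<in> {a<..<b}} / (b - a))"
      using k(2) c(1) by simp
    then show "c * (b - a) \<le> measure M {\<omega> \<in> space M. s powr (- 1 / \<beta>) * X s \<omega> \<in> {a<..<b}}"
      using ab by (simp add: pos_le_divide_eq)
  qed
qed

lemma prob_lower_density:
  assumes density: "\<And>a b s. - r \<le> a \<Longrightarrow> a < b \<Longrightarrow> b \<le> r \<Longrightarrow> 0 < s \<Longrightarrow> s \<le> T \<Longrightarrow>
      c * (b - a) \<le> measure M {\<omega> \<in> space M. s powr (- 1 / \<beta>) * X s \<omega> \<in> {a<..<b}}"
    and s: "0 < s" "s \<le> T" and ab: "- r * s powr (1 / \<beta>) \<le> a" "a < b" "b \<le> r * s powr (1 / \<beta>)"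
  shows "c * (b - a) * s powr (- 1 / \<beta>) \<le> measure M {\<omega> \<in> space M. a < X s \<omega> \<and> X s \<omega> < b}"
proof -
  define p where "p = s powr (1 / \<beta>)"
  have p: "0 < p" "s powr (- 1 / \<beta>) = inverse p"
    using s by (auto simp: p_def powr_minus[symmetric])
  have "c * (inverse p * b - inverse p * a)
      \<le> measure M {\<omega> \<in> space M. s powr (- 1 / \<beta>) * X s \<omega> \<in> {inverse p * a<..<inverse p * b}}"
    using ab p s unfolding p_def[symmetric]
    by (intro density) (auto simp: field_simps)
  also have "{\<omega> \<in> space M. s powr (- 1 / \<beta>) * X s \<omega> \<in> {inverse p * a<..<inverse p * b}}
      = {\<omega> \<in> space M. a < X s \<omega> \<and> X s \<omega> < b}"
    unfolding p(2) using p(1) by auto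
  finally show ?thesis unfolding p(2) by (simp add: algebra_simps)
qed

text \<open>
  Fubini: \<open>E (f (Y + z) - f Y)\<close> is the integral of \<open>P (y - z \<le> Y < y)\<close> against the measure of \<open>f\<close>.
\<close>

lemma (in prob_space) expectation_increment_ge:
  fixes f :: "real \<Rightarrow> real"
  assumes f: "mono f" "\<And>x. continuous (at_right x) f"
    and [measurable]: "Y \<in> borel_measurable M" "f \<in> borel_measurable borel"
    and int: "integrable M (\<lambda>\<omega>. f (Y \<omega>))" "integrable M (\<lambda>\<omega>. f (Y \<omega> + z))"
    and "0 \<le> z" and B: "B \<in> sets borel"
    and p: "\<And>y. y \<in> B \<Longrightarrow> p \<le> prob {\<omega> \<in> space M. y - z \<le> Y \<omega> \<and> Y \<omega> < y}"
  shows "ennreal p * emeasure (interval_measure f) B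
    \<le> ennreal (expectation (\<lambda>\<omega>. f (Y \<omega> + z)) - expectation (\<lambda>\<omega>. f (Y \<omega>)))"
proof -
  let ?\<mu> = "interval_measure f"
  have mono: "x \<le> y \<Longrightarrow> f x \<le> f y" for x y using f(1) by (rule monoD)
  interpret \<mu>: sigma_finite_measure ?\<mu>
    by (rule sigma_finite_interval_measure[OF mono f(2)])
  interpret P: pair_sigma_finite M ?\<mu> ..
  have le: "f (Y \<omega>) \<le> f (Y \<omega> + z)" for \<omega> using \<open>0 \<le> z\<close> by (intro mono) simp
  have [measurable]: "(\<lambda>(\<omega>, y). if y - z \<le> Y \<omega> \<and> Y \<omega> < y then 1 else 0 :: ennreal)
      \<in> borel_measurable (M \<Otimes>\<^sub>M ?\<mu>)"
    by measurable
  have "ennreal p * emeasure ?\<mu> B = (\<integral>\<^sup>+y. ennreal p * indicator B y \<partial>?\<mu>)"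
    using B by (simp add: nn_integral_cmult_indicator)
  also have "\<dots> \<le> (\<integral>\<^sup>+y. (\<integral>\<^sup>+\<omega>. (if y - z \<le> Y \<omega> \<and> Y \<omega> < y then 1 else 0) \<partial>M) \<partial>?\<mu>)"
  proof (rule nn_integral_mono)
    fix y
    have "(\<integral>\<^sup>+\<omega>. (if y - z \<le> Y \<omega> \<and> Y \<omega> < y then 1 else 0) \<partial>M)
        = (\<integral>\<^sup>+\<omega>. indicator {\<omega> \<in> space M. y - z \<le> Y \<omega> \<and> Y \<omega> < y} \<omega> \<partial>M)"
      by (intro nn_integral_cong) (auto split: split_indicator)
    also have "\<dots> = ennreal (prob {\<omega> \<in> space M. y - z \<le> Y \<omega> \<and> Y \<omega> < y})"
      by (subst nn_integral_indicator) (auto simp: emeasure_eq_measure)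
    finally show "ennreal p * indicator B y \<le> (\<integral>\<^sup>+\<omega>. (if y - z \<le> Y \<omega> \<and> Y \<omega> < y then 1 else 0) \<partial>M)"
      using p[of y] by (auto split: split_indicator intro!: ennreal_leI)
  qed
  also have "\<dots> = (\<integral>\<^sup>+\<omega>. (\<integral>\<^sup>+y. (if y - z \<le> Y \<omega> \<and> Y \<omega> < y then 1 else 0) \<partial>?\<mu>) \<partial>M)"
    by (rule P.Fubini') measurable
  also have "\<dots> = (\<integral>\<^sup>+\<omega>. ennreal (f (Y \<omega> + z) - f (Y \<omega>)) \<partial>M)"
  proof (rule nn_integral_cong)
    \<comment> \<open>For fixed \<open>Y \<omega>\<close> the condition on \<open>y\<close> reads
      \<open>Y \<omega> < y \<le> Y \<omega> + z\<close>. The choice of strict and weak inequalities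
      produces exactly the half-open interval on which \<open>interval_measure f\<close> is an
      increment of \<open>f\<close>.\<close>
    fix \<omega>
    have "(\<integral>\<^sup>+y. (if y - z \<le> Y \<omega> \<and> Y \<omega> < y then 1 else 0) \<partial>?\<mu>)
        = (\<integral>\<^sup>+y. indicator {Y \<omega><..Y \<omega> + z} y \<partial>?\<mu>)"
      by (intro nn_integral_cong) (auto split: split_indicator)
    also have "\<dots> = ennreal (f (Y \<omega> + z) - f (Y \<omega>))"
      using \<open>0 \<le> z\<close> by (subst nn_integral_indicator) (auto simp: emeasure_interval_measure_Ioc mono f(2))
    finally show "(\<integral>\<^sup>+y. (if y - z \<le> Y \<omega> \<and> Y \<omega> < y then 1 else 0) \<partial>?\<mu>)
        = ennreal (f (Y \<omega> + z) - f (Y \<omega>))" .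
  qed
  also have "\<dots> = ennreal (expectation (\<lambda>\<omega>. f (Y \<omega> + z) - f (Y \<omega>)))"
    using int le by (intro nn_integral_eq_integral Bochner_Integration.integrable_diff) auto
  also have "\<dots> = ennreal (expectation (\<lambda>\<omega>. f (Y \<omega> + z)) - expectation (\<lambda>\<omega>. f (Y \<omega>)))"
    using int by simp
  finally show ?thesis .
qed

text \<open>Freezing: the product law allows integrating out the increment with the past held fixed.
  It yields both the semigroup identity for \<open>F\<close> and the martingale property.\<close>

lemma (in levy) integral_past_increment:
  fixes h :: "'a \<times> real \<Rightarrow> real"
  assumes st: "0 \<le> s" "s < t" "t \<le> T"
    and h [measurable]: "h \<in> borel_measurable (\<F> s \<Otimes>\<^sub>M borel)"
    and int: "integrable M (\<lambda>\<omega>. h (\<omega>, X t \<omega> - X s \<omega>))"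
  shows "expectation (\<lambda>\<omega>. h (\<omega>, X t \<omega> - X s \<omega>))
    = expectation (\<lambda>\<omega>. LINT y|distr M borel (X (t - s)). h (\<omega>, y))"
proof -
  have [measurable]: "X t \<in> borel_measurable M" "X s \<in> borel_measurable M" "X (t - s) \<in> borel_measurable M"
    using st by (auto intro: X_measurable)
  have [measurable]: "(\<lambda>\<omega>. \<omega>) \<in> M \<rightarrow>\<^sub>M \<F> s"
    using subalgebra_augmented_filtration[of s] st by (auto simp: subalgebra_def intro!: measurableI)
  let ?N = "distr M (\<F> s) (\<lambda>\<omega>. \<omega>)" and ?L = "distr M borel (X (t - s))"
  interpret P1: prob_space ?N by (rule prob_space_distr) measurable
  interpret P2: prob_space ?L by (rule prob_space_distr) measurable
  interpret P: pair_prob_space ?N ?L ..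
  note eq = distr_past_increment[OF st]
  have "expectation (\<lambda>\<omega>. h (\<omega>, X t \<omega> - X s \<omega>)) = integral\<^sup>L (?N \<Otimes>\<^sub>M ?L) h"
    unfolding eq by (subst integral_distr) auto
  also have "\<dots> = (LINT \<omega>|?N. LINT y|?L. h (\<omega>, y))"
  proof (rule P.integral_fst'[symmetric])
    show "integrable (?N \<Otimes>\<^sub>M ?L) h"
      unfolding eq using int by (subst integrable_distr_eq) auto
  qed
  also have "\<dots> = expectation (\<lambda>\<omega>. LINT y|?L. h (\<omega>, y))"
    by (rule integral_distr) measurable
  finally show ?thesis .
qed

subsection \<open>The gradient of the smoothed function along the process\<close>

text \<open>Splits off the shift by 1 used in the interpolation, so that integrability of
  \<open>p powr (1 - \<eta>)\<close> against a probability measure suffices. The factor 2 bounds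
  \<open>2 powr \<theta>\<close>.\<close>

lemma powr_add_1_le:
  fixes p \<theta> :: real
  assumes "0 \<le> p" "0 \<le> \<theta>" "\<theta> \<le> 1"
  shows "(p + 1) powr \<theta> \<le> 2 * (p powr \<theta> + 1)"
proof -
  have 2: "2 powr \<theta> \<le> (2 :: real)" using powr_mono[of \<theta> 1 2] assms by simp
  show ?thesis
  proof (cases "p \<le> 1")
    case True
    then have "(p + 1) powr \<theta> \<le> 2 powr \<theta>" using assms by (intro powr_mono2) auto
    also note 2
    also have "2 \<le> 2 * (p powr \<theta> + 1)" by simp
    finally show ?thesis .
  next
    case False
    then have "(p + 1) powr \<theta> \<le> (2 * p) powr \<theta>" using assms by (intro powr_mono2) auto
    also have "\<dots> \<le> 2 * p powr \<theta>"
      using assms 2 by (simp add: powr_mult mult_right_mono)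
    finally show ?thesis by simp
  qed
qed

text \<open>A finite infimum has a competitor \<open>P\<close> with finite integral.
  \<open>P\<close> lives off 0; extended by 0 it is Borel on the line and its power contributes
  nothing at 0.\<close>

lemma (in prob_space) finite_TV_rhoD:
  assumes TV: "TV_rho M \<rho> \<eta> Y < \<infinity>" and "\<eta> < 1" and [measurable_cong]: "sets \<rho> = sets borel"
  obtains p where "p \<in> borel_measurable borel" "\<And>z. 0 \<le> p z"
    "integrable \<rho> (\<lambda>z. p z powr (1 - \<eta>))"
    "\<And>z. z \<noteq> 0 \<Longrightarrow> TV_dist (distr M borel (\<lambda>\<omega>. z + Y \<omega>)) (distr M borel Y) \<le> ennreal (\<bar>z\<bar> * p z)"
proof -
  obtain P where P: "P \<in> borel_measurable (restrict_space borel (- {0 :: real}))"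
    and TV_P: "\<And>z. z \<noteq> 0 \<Longrightarrow> 0 \<le> P z \<and>
      TV_dist (distr M borel (\<lambda>\<omega>. z + Y \<omega>)) (distr M borel Y) / ennreal \<bar>z\<bar> \<le> ennreal (P z)"
    and fin: "(\<integral>\<^sup>+z\<in>- {0}. ennreal (if \<eta> = 1 then 1 else P z powr (1 - \<eta>)) \<partial>\<rho>) < \<infinity>"
    using TV unfolding TV_rho_def INF_less_iff by blast
  define p where "p z = indicator (- {0}) z * P z" for z
  have p [measurable]: "p \<in> borel_measurable borel"
    using P unfolding p_def by (subst (asm) borel_measurable_restrict_space_iff) auto
  show ?thesis
  proof (rule that[OF p])
    show "0 \<le> p z" for z using TV_P[of z] by (auto simp: p_def split: split_indicator)
    have "(\<integral>\<^sup>+z. ennreal (p z powr (1 - \<eta>)) \<partial>\<rho>)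
        = (\<integral>\<^sup>+z\<in>- {0}. ennreal (if \<eta> = 1 then 1 else P z powr (1 - \<eta>)) \<partial>\<rho>)"
      using \<open>\<eta> < 1\<close> by (intro nn_integral_cong) (auto simp: p_def split: split_indicator)
    then show "integrable \<rho> (\<lambda>z. p z powr (1 - \<eta>))"
      using fin by (intro integrableI_nonneg) auto
    fix z :: real assume z: "z \<noteq> 0"
    let ?d = "TV_dist (distr M borel (\<lambda>\<omega>. z + Y \<omega>)) (distr M borel Y)"
    have "?d = ?d / ennreal \<bar>z\<bar> * ennreal \<bar>z\<bar>"
      using z by (simp add: ennreal_divide_times ennreal_divide_self)
    also have "\<dots> \<le> ennreal (P z) * ennreal \<bar>z\<bar>"
      using TV_P[OF z] by (intro mult_right_mono) auto
    also have "\<dots> = ennreal (\<bar>z\<bar> * p z)"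
      using TV_P[OF z] z by (simp add: p_def ennreal_mult mult.commute)
    finally show "?d \<le> ennreal (\<bar>z\<bar> * p z)" .
  qed
qed

locale levy_gradient = levy M T X for M :: "'a measure" and T X +
  fixes \<rho> :: "real measure" and f :: "real \<Rightarrow> real" and \<eta> H :: real
  assumes rho: "prob_space \<rho>" "sets \<rho> = sets borel"
    and eta: "0 < \<eta>" "\<eta> < 1" and H: "0 < H"
    and Hoelder_f: "\<And>x y. \<bar>f x - f y\<bar> \<le> H * \<bar>x - y\<bar> powr \<eta>"
    and mono_f: "mono f"
    and moment: "\<And>t. t \<in> {0..T} \<Longrightarrow> integrable M (\<lambda>\<omega>. \<bar>X t \<omega>\<bar> powr \<eta>)"
    and TV: "\<And>s. s \<in> {0<..T} \<Longrightarrow> TV_rho M \<rho> \<eta> (X s) < \<infinity>"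
begin

abbreviation "F \<equiv> F_fun M T X f"
abbreviation "G t \<equiv> diffquot \<rho> (F t)"

lemma f_measurable [measurable]: "f \<in> borel_measurable borel"
  using Hoelder_isCont[OF Hoelder_f eta(1)]
  by (intro borel_measurable_continuous_onI continuous_at_imp_continuous_on) auto

lemma integrable_f_X:
  assumes t: "t \<in> {0..T}"
  shows "integrable M (\<lambda>\<omega>. f (x + X t \<omega>))"
proof (rule Bochner_Integration.integrable_bound)
  note [measurable] = X_measurable[OF t]
  show "integrable M (\<lambda>\<omega>. \<bar>f x\<bar> + H * \<bar>X t \<omega>\<bar> powr \<eta>)"
    using moment[OF t] by auto
  have "\<bar>f (x + X t \<omega>)\<bar> \<le> \<bar>f x\<bar> + H * \<bar>X t \<omega>\<bar> powr \<eta>" for \<omega>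
    using Hoelder_f[of "x + X t \<omega>" x] by simp
  then show "AE \<omega> in M. norm (f (x + X t \<omega>)) \<le> norm (\<bar>f x\<bar> + H * \<bar>X t \<omega>\<bar> powr \<eta>)"
    by (intro AE_I2) (smt (verit) real_norm_def)
  show "(\<lambda>\<omega>. f (x + X t \<omega>)) \<in> borel_measurable M" by measurable
qed

lemma Hoelder_F:
  assumes "t \<in> {0..T}"
  shows "\<bar>F t x - F t y\<bar> \<le> H * \<bar>x - y\<bar> powr \<eta>"
proof -
  have t: "T - t \<in> {0..T}" using assms by auto
  have "\<bar>F t x - F t y\<bar> = \<bar>expectation (\<lambda>\<omega>. f (x + X (T - t) \<omega>) - f (y + X (T - t) \<omega>))\<bar>"
    unfolding F_fun_def using integrable_f_X[OF t] by simp
  also have "\<dots> \<le> expectation (\<lambda>\<omega>. \<bar>f (x + X (T - t) \<omega>) - f (y + X (T - t) \<omega>)\<bar>)"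
    by (rule integral_abs_bound)
  also have "\<dots> \<le> expectation (\<lambda>\<omega>. H * \<bar>x - y\<bar> powr \<eta>)"
  proof (rule integral_mono)
    fix \<omega> show "\<bar>f (x + X (T - t) \<omega>) - f (y + X (T - t) \<omega>)\<bar> \<le> H * \<bar>x - y\<bar> powr \<eta>"
      using Hoelder_f[of "x + X (T - t) \<omega>" "y + X (T - t) \<omega>"] by simp
  qed (use integrable_f_X[OF t] in auto)
  finally show ?thesis by (simp add: prob_space)
qed

lemma mono_F: "t \<in> {0..T} \<Longrightarrow> mono (F t)"
  unfolding F_fun_def using integrable_f_X[of "T - t"]
  by (intro monoI integral_mono monoD[OF mono_f]) auto

lemma dominated_F:
  assumes "t \<in> {0..<T}"
  shows "\<exists>Q. dominated_diffquot \<rho> (F t) Q"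
proof -
  have s: "T - t \<in> {0<..T}" "T - t \<in> {0..T}" "t \<in> {0..T}" using assms by auto
  obtain p where p: "p \<in> borel_measurable borel" "\<And>z. 0 \<le> p z"
    "integrable \<rho> (\<lambda>z. p z powr (1 - \<eta>))"
    "\<And>z. z \<noteq> 0 \<Longrightarrow> TV_dist (distr M borel (\<lambda>\<omega>. z + X (T - t) \<omega>)) (distr M borel (X (T - t)))
        \<le> ennreal (\<bar>z\<bar> * p z)"
    using finite_TV_rhoD[OF TV[OF s(1)] eta(2) rho(2)] by metis
  interpret \<rho>: prob_space \<rho> by (rule rho)
  \<comment> \<open>The constant 4 is the 2 of \<open>TV_interpolation\<close> times the 2 of
    \<open>powr_add_1_le\<close>.\<close>
  define Q where "Q z = 4 * H * (p z powr (1 - \<eta>) + 1)" for z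
  have "dominated_diffquot \<rho> (F t) Q"
  proof unfold_locales
    show "sets \<rho> = sets borel" by (rule rho)
    show "integrable \<rho> Q" unfolding Q_def using p(3) by auto
    show "0 \<le> Q z" for z using H by (simp add: Q_def)
    show "isCont (F t) x" for x by (rule Hoelder_isCont[OF Hoelder_F[OF s(3)] eta(1)])
    fix x z
    show "\<bar>F t (x + z) - F t x\<bar> \<le> \<bar>z\<bar> * Q z"
    proof (cases "z = 0")
      case False
      have "\<bar>F t (x + z) - F t x\<bar> \<le> \<bar>z\<bar> * (2 * H * (p z + 1) powr (1 - \<eta>))"
        unfolding F_fun_def
        by (rule TV_interpolation[OF Hoelder_f eta H X_measurable[OF s(2)] integrable_f_X[OF s(2)] p(4)[OF False] p(2)])
      also have "\<dots> \<le> \<bar>z\<bar> * (2 * H * (2 * (p z powr (1 - \<eta>) + 1)))"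
        using H eta p(2)[of z] by (intro mult_left_mono powr_add_1_le) auto
      finally show ?thesis by (simp add: Q_def mult_ac)
    qed simp
  qed
  then show ?thesis by blast
qed

lemma isCont_G: "t \<in> {0..<T} \<Longrightarrow> isCont (G t) x"
  using dominated_F dominated_diffquot.isCont_diffquot by blast

lemma G_measurable: "t \<in> {0..<T} \<Longrightarrow> G t \<in> borel_measurable borel"
  using dominated_F dominated_diffquot.diffquot_measurable by blast

lemma G_nonneg: "t \<in> {0..<T} \<Longrightarrow> 0 \<le> G t x"
  using dominated_F[of t] dominated_diffquot.diffquot_nonneg[OF _ mono_F[of t]] by auto

lemma G_bounded: "t \<in> {0..<T} \<Longrightarrow> \<exists>C. \<forall>x. \<bar>G t x\<bar> \<le> C"
  using dominated_F dominated_diffquot.abs_diffquot_le by blast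

lemma G_arbitrarily_small:
  assumes t: "t \<in> {0..<T}" and "0 < e"
  shows "\<exists>x. G t x < e"
proof -
  obtain Q where Q: "dominated_diffquot \<rho> (F t) Q" using dominated_F[OF t] by blast
  show ?thesis
    by (rule dominated_diffquot.diffquot_arbitrarily_small[OF Q mono_F Hoelder_F eta \<open>0 < e\<close>])
       (use t in auto)
qed

text \<open>The semigroup property, with \<open>X (T - s)\<close> split into
  \<open>X (t - s)\<close> and an independent increment distributed as
  \<open>X (T - t)\<close>.\<close>

lemma F_shift:
  assumes st: "0 \<le> s" "s < t" "t < T"
  shows "F s x = (LINT y|distr M borel (X (t - s)). F t (x + y))"
proof -
  have [measurable]: "X (t - s) \<in> borel_measurable M" "X (T - t) \<in> borel_measurable M"
    "X (t - s) \<in> borel_measurable (\<F> (t - s))"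
    using st by (auto intro: X_measurable X_measurable_augmented_filtration)
  have [measurable]: "F t \<in> borel_measurable borel"
    using Hoelder_isCont[OF Hoelder_F[of t] eta(1)] st
    by (intro borel_measurable_continuous_onI continuous_at_imp_continuous_on) auto
  \<comment> \<open>The path is cut at time \<open>t - s\<close>, so that the remaining increment
    has duration \<open>T - t\<close>, the one defining \<open>F t\<close>.\<close>
  let ?h = "\<lambda>(\<omega>, y). f (x + X (t - s) \<omega> + y)"
  have eq: "?h (\<omega>, X (T - s) \<omega> - X (t - s) \<omega>) = f (x + X (T - s) \<omega>)" for \<omega> by simp
  have "F s x = expectation (\<lambda>\<omega>. ?h (\<omega>, X (T - s) \<omega> - X (t - s) \<omega>))"
    unfolding eq by (simp add: F_fun_def)
  also have "\<dots> = expectation (\<lambda>\<omega>. LINT y|distr M borel (X (T - s - (t - s))). ?h (\<omega>, y))"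
  proof (rule integral_past_increment)
    show "?h \<in> borel_measurable (\<F> (t - s) \<Otimes>\<^sub>M borel)" by measurable
    show "integrable M (\<lambda>\<omega>. ?h (\<omega>, X (T - s) \<omega> - X (t - s) \<omega>))"
      unfolding eq using st by (intro integrable_f_X) auto
  qed (use st in auto)
  also have "\<dots> = expectation (\<lambda>\<omega>. F t (x + X (t - s) \<omega>))"
    by (simp add: F_fun_def integral_distr)
  also have "\<dots> = (LINT y|distr M borel (X (t - s)). F t (x + y))"
    by (subst integral_distr) auto
  finally show ?thesis .
qed

text \<open>Averaging commutes with \<open>diffquot\<close>, so the semigroup identity passes from
  \<open>F\<close> to \<open>G\<close>. This is the martingale property at the level of
  functions.\<close>

lemma G_shift:
  assumes st: "0 \<le> s" "s < t" "t < T"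
  shows "(LINT y|distr M borel (X (t - s)). G t (x + y)) = G s x"
proof -
  have [measurable]: "X (t - s) \<in> borel_measurable M" using st by (auto intro: X_measurable)
  have t: "t \<in> {0..<T}" using st by auto
  obtain Q where Q: "dominated_diffquot \<rho> (F t) Q" using dominated_F[OF t] by blast
  have [measurable]: "F t \<in> borel_measurable borel"
    using Q by (rule dominated_diffquot.u_measurable)
  have t0: "t \<in> {0..T}" "t - s \<in> {0..T}" using st by auto
  have int: "integrable (distr M borel (X (t - s))) (\<lambda>y. F t (x + y))" for x
  proof -
    have "integrable M (\<lambda>\<omega>. F t (x + X (t - s) \<omega>))"
    proof (rule Bochner_Integration.integrable_bound)
      show "integrable M (\<lambda>\<omega>. \<bar>F t x\<bar> + H * \<bar>X (t - s) \<omega>\<bar> powr \<eta>)"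
        using moment[OF t0(2)] by auto
      have "\<bar>F t (x + X (t - s) \<omega>)\<bar> \<le> \<bar>F t x\<bar> + H * \<bar>X (t - s) \<omega>\<bar> powr \<eta>" for \<omega>
        using Hoelder_F[OF t0(1), of "x + X (t - s) \<omega>" x] by simp
      then show "AE \<omega> in M. norm (F t (x + X (t - s) \<omega>)) \<le> norm (\<bar>F t x\<bar> + H * \<bar>X (t - s) \<omega>\<bar> powr \<eta>)"
        by (intro AE_I2) (smt (verit) real_norm_def)
    qed measurable
    then show ?thesis by (subst integrable_distr_eq) auto
  qed
  have "(LINT y|distr M borel (X (t - s)). G t (x + y))
      = diffquot \<rho> (\<lambda>x. LINT y|distr M borel (X (t - s)). F t (x + y)) x"
    by (rule dominated_diffquot.integral_diffquot_shift[OF Q _ _ int]) (auto intro!: prob_space_distr)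
  also have "(\<lambda>x. LINT y|distr M borel (X (t - s)). F t (x + y)) = F s"
    using F_shift[OF st] by auto
  finally show ?thesis .
qed

lemma integrable_G_X:
  assumes "t \<in> {0..<T}" shows "integrable M (\<lambda>\<omega>. G t (X t \<omega>))"
proof -
  have [measurable]: "X t \<in> borel_measurable M" "G t \<in> borel_measurable borel"
    using assms by (auto intro: X_measurable G_measurable)
  obtain C where "\<And>x. \<bar>G t x\<bar> \<le> C" using G_bounded[OF assms] by auto
  then show ?thesis by (intro integrable_const_bound[of _ C]) auto
qed

lemma set_integral_G_X:
  assumes st: "0 \<le> s" "s < t" "t < T" and A: "A \<in> sets (\<F> s)"
  shows "(LINT \<omega>:A|M. G t (X t \<omega>)) = (LINT \<omega>:A|M. G s (X s \<omega>))"
proof -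
  have t: "t \<in> {0..<T}" using st by auto
  note [measurable] = A G_measurable[OF t]
  have [measurable]: "X s \<in> borel_measurable (\<F> s)" "X t \<in> borel_measurable M" "X s \<in> borel_measurable M"
    using st by (auto intro: X_measurable X_measurable_augmented_filtration)
  have AM [measurable]: "A \<in> events"
    using A subalgebra_augmented_filtration[of s] st by (auto simp: subalgebra_def)
  obtain C where C: "\<And>x. \<bar>G t x\<bar> \<le> C" using G_bounded[OF t] by auto
  let ?h = "\<lambda>(\<omega>, y). indicator A \<omega> * G t (X s \<omega> + y)"
  have eq: "?h (\<omega>, X t \<omega> - X s \<omega>) = indicator A \<omega> * G t (X t \<omega>)" for \<omega> by simp
  have "expectation (\<lambda>\<omega>. ?h (\<omega>, X t \<omega> - X s \<omega>))
      = expectation (\<lambda>\<omega>. LINT y|distr M borel (X (t - s)). ?h (\<omega>, y))"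
  proof (rule integral_past_increment)
    show "?h \<in> borel_measurable (\<F> s \<Otimes>\<^sub>M borel)" by measurable
    have "integrable M (\<lambda>\<omega>. indicator A \<omega> *\<^sub>R G t (X t \<omega>))"
      by (intro integrable_mult_indicator AM integrable_G_X t)
    then show "integrable M (\<lambda>\<omega>. ?h (\<omega>, X t \<omega> - X s \<omega>))" unfolding eq by simp
  qed (use st in auto)
  then show ?thesis
    unfolding eq by (simp add: set_lebesgue_integral_def G_shift[OF st])
qed

text \<open>Since \<open>X s\<close> and the increment up to \<open>t\<close> are independent and
  have full support, the pair \<open>(X s, X t)\<close> is close to \<open>(0, y)\<close> with
  positive probability. Continuity then turns an almost sure bound into one at this pair.\<close>

lemma G_le_of_AE_le:
  assumes st: "0 \<le> s" "s < t" "t < T"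
    and supp: "\<And>u x e. 0 < u \<Longrightarrow> u \<le> T \<Longrightarrow> 0 < e \<Longrightarrow> 0 < prob {\<omega> \<in> space M. \<bar>X u \<omega> - x\<bar> < e}"
    and le: "AE \<omega> in M. \<bar>G t (X t \<omega>) - G s (X s \<omega>)\<bar> \<le> k"
  shows "\<bar>G t y - G s 0\<bar> \<le> k"
proof (rule ccontr)
  assume neg: "\<not> ?thesis"
  have t: "t \<in> {0..<T}" "s \<in> {0..<T}" using st by auto
  have [measurable]: "X t \<in> borel_measurable M" "X s \<in> borel_measurable M"
    using st by (auto intro: X_measurable)
  \<comment> \<open>Half of the assumed excess, since continuity is used twice, at \<open>y\<close>
    and at 0.\<close>
  define e where "e = (\<bar>G t y - G s 0\<bar> - k) / 2"
  have e: "0 < e" using neg by (simp add: e_def)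
  obtain d1 where d1: "0 < d1" "\<And>x. \<bar>x - y\<bar> < d1 \<Longrightarrow> \<bar>G t x - G t y\<bar> < e"
    using isCont_G[OF t(1), of y] e unfolding continuous_at_eps_delta by (metis dist_real_def)
  obtain d2 where d2: "0 < d2" "\<And>x. \<bar>x - 0\<bar> < d2 \<Longrightarrow> \<bar>G s x - G s 0\<bar> < e"
    using isCont_G[OF t(2), of 0] e unfolding continuous_at_eps_delta by (metis dist_real_def)
  \<comment> \<open>\<open>X t - y\<close> is the sum of \<open>X s\<close> and the error of the
    increment, each below \<open>d\<close>; hence half of \<open>d1\<close>.\<close>
  define d where "d = min (d1 / 2) d2"
  have d: "0 < d" using d1 d2 by (simp add: d_def)
  define A where "A = {\<omega> \<in> space M. X s \<omega> \<in> {- d<..<d}}"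
  define B where "B = {\<omega> \<in> space M. X t \<omega> - X s \<omega> \<in> {y - d<..<y + d}}"
  have "A \<in> sets (\<F> s)"
    using measurable_sets[OF X_measurable_augmented_filtration[of s s], of "{- d<..<d}"] st
    by (simp add: A_def vimage_def Int_def conj_commute)
  then have "prob (A \<inter> B) = prob A * prob B"
    unfolding B_def using st by (intro prob_past_increment) auto
  moreover have "0 < prob A"
  proof (cases "s = 0")
    case True
    then have "A = space M" using X_0 d by (auto simp: A_def)
    then show ?thesis by (simp add: prob_space)
  next
    case False
    have "A = {\<omega> \<in> space M. \<bar>X s \<omega> - 0\<bar> < d}" by (auto simp: A_def)
    then show ?thesis using supp[of s d 0] st d False by simp
  qed
  moreover have "0 < prob B"
  proof -
    have "prob B = prob {\<omega> \<in> space M. X (t - s) \<omega> \<in> {y - d<..<y + d}}"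
      unfolding B_def using st by (intro prob_increment) auto
    also have "{\<omega> \<in> space M. X (t - s) \<omega> \<in> {y - d<..<y + d}} = {\<omega> \<in> space M. \<bar>X (t - s) \<omega> - y\<bar> < d}"
      by auto
    finally show ?thesis using supp[of "t - s" d y] st d by simp
  qed
  ultimately have "0 < prob (A \<inter> B)" by simp
  moreover have "AE \<omega> in M. \<omega> \<notin> A \<inter> B"
    using le
  proof (rule AE_mp, intro AE_I2 impI notI)
    fix \<omega> assume "\<bar>G t (X t \<omega>) - G s (X s \<omega>)\<bar> \<le> k" and \<omega>: "\<omega> \<in> A \<inter> B"
    moreover have "\<bar>G s (X s \<omega>) - G s 0\<bar> < e"
      using \<omega> by (intro d2) (auto simp: A_def d_def)
    moreover have "\<bar>G t (X t \<omega>) - G t y\<bar> < e"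
      using \<omega> by (intro d1(2)) (auto simp: A_def B_def d_def)
    ultimately show False unfolding e_def by (simp add: field_simps) (smt (verit))
  qed
  then have "prob (A \<inter> B) = 0"
    by (subst (asm) AE_iff_measurable[of "A \<inter> B"]) (auto simp: A_def B_def emeasure_eq_measure)
  ultimately show False by simp
qed

lemma G_le_twice_oscillation:
  assumes st: "0 \<le> s" "s < t" "t < T"
    and supp: "\<And>u x e. 0 < u \<Longrightarrow> u \<le> T \<Longrightarrow> 0 < e \<Longrightarrow> 0 < prob {\<omega> \<in> space M. \<bar>X u \<omega> - x\<bar> < e}"
    and le: "AE \<omega> in M. \<bar>G t (X t \<omega>) - G s (X s \<omega>)\<bar> \<le> k"
  shows "G t y \<le> 2 * k"
proof -
  have le': "\<bar>G t y - G s 0\<bar> \<le> k" for y by (rule G_le_of_AE_le[OF st supp le])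
  have "G s 0 \<le> k + e" if e: "0 < e" for e
  proof -
    obtain x where "G t x < e" using G_arbitrarily_small[of t e, OF _ e] st by auto
    then show ?thesis using le'[of x] by linarith
  qed
  then have "G s 0 \<le> k" by (rule field_le_epsilon)
  then show ?thesis using le'[of y] by linarith
qed

text \<open>At the scale \<open>d = \<delta> * p\<close> with
  \<open>p = (T - t) powr (1 / \<beta>)\<close>, the process charges suitable intervals of length
  \<open>\<bar>z\<bar>\<close> with at least \<open>c * \<bar>z\<bar> / p\<close>. Integrating
  against the measure of \<open>f\<close> on \<open>{-d..d}\<close> bounds the quotient below by a
  multiple of \<open>d powr \<eta> / p\<close>, and \<rho> contributes
  \<open>d powr \<epsilon>\<close>. The product has order
  \<open>p powr (\<epsilon> + \<eta> - 1)\<close>.\<close>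

lemma G_0_lower_bound:
  assumes rho0: "emeasure \<rho> {0} = 0" and beta: "0 < \<beta>"
    and mass: "lower_mass \<epsilon> \<rho>" "lower_mass \<eta> (interval_measure f)"
    and density: "0 < r" "0 < c" "\<And>a b s. - r \<le> a \<Longrightarrow> a < b \<Longrightarrow> b \<le> r \<Longrightarrow> 0 < s \<Longrightarrow> s \<le> T \<Longrightarrow>
      c * (b - a) \<le> prob {\<omega> \<in> space M. s powr (- 1 / \<beta>) * X s \<omega> \<in> {a<..<b}}"
  shows "\<exists>C>0. \<forall>t\<in>{0..<T}. C * (T - t) powr (- ((1 - (\<epsilon> + \<eta>)) / \<beta>)) \<le> G t 0"
proof -
  interpret \<rho>: prob_space \<rho> by (rule rho)
  note [measurable_cong] = rho(2)
  have right_cont: "continuous (at_right x) f" for x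
    using Hoelder_isCont[OF Hoelder_f eta(1)] continuous_at_imp_continuous_at_within by blast
  obtain \<kappa>1 d1 where 1: "0 < \<kappa>1" "0 < d1"
    "\<And>d. 0 < d \<Longrightarrow> d < d1 \<Longrightarrow> ennreal (\<kappa>1 * d powr \<epsilon>) \<le> emeasure \<rho> {-d..d}"
    using lower_massD[OF mass(1)] by metis
  obtain \<kappa>2 d2 where 2: "0 < \<kappa>2" "0 < d2"
    "\<And>d. 0 < d \<Longrightarrow> d < d2 \<Longrightarrow> ennreal (\<kappa>2 * d powr \<eta>) \<le> emeasure (interval_measure f) {-d..d}"
    using lower_massD[OF mass(2)] by metis
  \<comment> \<open>Independent of \<open>t\<close>: the first entry gives
    \<open>2 * d \<le> r * p\<close>, the density window, because the intervals below reach up to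
    distance \<open>2 * d\<close>; the second gives \<open>d < d1\<close> and \<open>d < d2\<close>
    as \<open>p \<le> T powr (1 / \<beta>)\<close>.\<close>
  define \<delta> where "\<delta> = min (r / 2) (min d1 d2 / (2 * T powr (1 / \<beta>)))"
  have \<delta>: "0 < \<delta>" using density(1) 1(2) 2(2) T_pos by (simp add: \<delta>_def)
  define C where "C = c * \<kappa>1 * \<kappa>2 * \<delta> powr (\<epsilon> + \<eta>)"
  show ?thesis
  proof (intro exI[of _ C] conjI ballI)
    show "0 < C" using density(2) 1(1) 2(1) \<delta> by (simp add: C_def)
    fix t assume t: "t \<in> {0..<T}"
    define s where "s = T - t"
    have s: "0 < s" "s \<le> T" using t by (auto simp: s_def)
    have [measurable]: "X s \<in> borel_measurable M" using s by (auto intro: X_measurable)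
    define p where "p = s powr (1 / \<beta>)"
    have p: "0 < p" "p \<le> T powr (1 / \<beta>)" using s beta by (auto simp: p_def intro: powr_mono2)
    have p_inv: "s powr (- 1 / \<beta>) = 1 / p" by (simp add: p_def powr_minus_divide)
    define d where "d = \<delta> * p"
    have d: "0 < d" using \<delta> p by (simp add: d_def)
    have "\<delta> * p \<le> min d1 d2 / (2 * T powr (1 / \<beta>)) * T powr (1 / \<beta>)"
      using p \<delta> by (intro mult_mono) (auto simp: \<delta>_def)
    also have "\<dots> = min d1 d2 / 2" using T_pos by simp
    finally have d12: "d < d1" "d < d2" using 1(2) 2(2) by (auto simp: d_def)
    have dr: "2 * d \<le> r * p" using p by (auto simp: d_def \<delta>_def min_def field_simps)
    have prob_ge: "c * (b - a) / p \<le> prob {\<omega> \<in> space M. a < X s \<omega> \<and> X s \<omega> < b}"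
      if "- (2 * d) \<le> a" "a < b" "b \<le> 2 * d" for a b
      using prob_lower_density[where a = a and b = b and r = r, OF density(3) s] that dr
      unfolding p_inv p_def[symmetric] by simp
    have quot_ge: "c / p * (\<kappa>2 * d powr \<eta>) \<le> (F t (0 + z) - F t 0) / z"
      if z: "z \<noteq> 0" "\<bar>z\<bar> \<le> d" for z
    proof -
      have int: "integrable M (\<lambda>\<omega>. f (X s \<omega> + x))" for x
        using integrable_f_X[of s x] s by (simp add: add.commute)
      have F: "F t x = expectation (\<lambda>\<omega>. f (X s \<omega> + x))" for x
        by (simp add: F_fun_def s_def add.commute)
      \<comment> \<open>Starting at the left end \<open>w\<close> of the interval between 0 and
        \<open>z\<close> treats both signs of \<open>z\<close> at once.\<close>
      have diff_ge: "c * \<bar>z\<bar> / p * (\<kappa>2 * d powr \<eta>) \<le> F t (w + \<bar>z\<bar>) - F t w" if w: "w = min z 0" for w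
      proof -
        have "ennreal (c * \<bar>z\<bar> / p) * emeasure (interval_measure f) {-d..d}
            \<le> ennreal (expectation (\<lambda>\<omega>. f ((X s \<omega> + w) + \<bar>z\<bar>)) - expectation (\<lambda>\<omega>. f (X s \<omega> + w)))"
        proof (rule expectation_increment_ge[OF mono_f right_cont])
          show "integrable M (\<lambda>\<omega>. f (X s \<omega> + w))" by (rule int)
          show "integrable M (\<lambda>\<omega>. f (X s \<omega> + w + \<bar>z\<bar>))" using int[of "w + \<bar>z\<bar>"] by (simp add: add.assoc)
          fix y assume y: "y \<in> {-d..d}"
          have "c * ((y - w) - (y - w - \<bar>z\<bar>)) / p
              \<le> prob {\<omega> \<in> space M. y - w - \<bar>z\<bar> < X s \<omega> \<and> X s \<omega> < y - w}"
            using y z w by (intro prob_ge) auto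
          also have "\<dots> \<le> prob {\<omega> \<in> space M. y - \<bar>z\<bar> \<le> X s \<omega> + w \<and> X s \<omega> + w < y}"
            by (intro finite_measure_mono) auto
          finally show "c * \<bar>z\<bar> / p \<le> prob {\<omega> \<in> space M. y - \<bar>z\<bar> \<le> X s \<omega> + w \<and> X s \<omega> + w < y}"
            by simp
        qed auto
        then have "ennreal (c * \<bar>z\<bar> / p) * ennreal (\<kappa>2 * d powr \<eta>)
            \<le> ennreal (F t (w + \<bar>z\<bar>) - F t w)"
          unfolding F add.assoc
          using 2(3)[OF d d12(2)] by (meson mult_left_mono order_trans zero_le)
        moreover have "F t w \<le> F t (w + \<bar>z\<bar>)"
          using t by (intro monoD[OF mono_F]) auto
        ultimately show ?thesis
          using density(2) p(1) 2(1) by (simp flip: ennreal_mult)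
      qed
      have "(F t (0 + z) - F t 0) / z = (F t (min z 0 + \<bar>z\<bar>) - F t (min z 0)) / \<bar>z\<bar>"
        using z(1) by (cases "z > 0") (auto simp: divide_simps)
      moreover have "c / p * (\<kappa>2 * d powr \<eta>) = c * \<bar>z\<bar> / p * (\<kappa>2 * d powr \<eta>) / \<bar>z\<bar>"
        using z(1) by simp
      ultimately show ?thesis
        using diff_ge[OF refl] by (metis abs_ge_zero divide_right_mono)
    qed
    obtain Q where Q: "dominated_diffquot \<rho> (F t) Q" using dominated_F[OF t] by blast
    define m where "m = c / p * (\<kappa>2 * d powr \<eta>)"
    have m: "0 \<le> m" using density(2) p(1) 2(1) by (simp add: m_def)
    have "(\<kappa>1 * d powr \<epsilon>) * m \<le> measure \<rho> {-d..d} * m"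
      using 1(3)[OF d d12(1)] m by (intro mult_right_mono) (auto simp: \<rho>.emeasure_eq_measure)
    also have "\<dots> = (LINT z|\<rho>. indicator {-d..d} z * m)"
      by (simp add: rho(2))
    also have "\<dots> \<le> (LINT z|\<rho>. (F t (0 + z) - F t 0) / z)"
    proof (rule integral_mono_AE)
      show "integrable \<rho> (\<lambda>z. indicator {-d..d} z * m)"
        by (intro integrable_mult_left) (simp add: integrable_indicator_iff rho(2) \<rho>.emeasure_eq_measure)
      show "integrable \<rho> (\<lambda>z. (F t (0 + z) - F t 0) / z)"
        by (rule dominated_diffquot.integrable_quot[OF Q])
      \<comment> \<open>At \<open>z = 0\<close> the quotient is 0 by convention, so the positive
        lower bound can only hold almost everywhere.\<close>
      have "{0} \<in> null_sets \<rho>" using rho0 by (simp add: null_sets_def rho(2))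
      then have "AE z in \<rho>. z \<noteq> 0" by (rule AE_I') auto
      then show "AE z in \<rho>. indicator {-d..d} z * m \<le> (F t (0 + z) - F t 0) / z"
      proof (rule eventually_mono)
        fix z :: real assume z: "z \<noteq> 0"
        show "indicator {-d..d} z * m \<le> (F t (0 + z) - F t 0) / z"
        proof (cases "z \<in> {-d..d}")
          case True
          then show ?thesis using quot_ge[OF z] by (simp add: m_def abs_le_iff)
        next
          case False
          then show ?thesis using dominated_diffquot.quot_nonneg[OF Q mono_F, of 0 z] t by simp
        qed
      qed
    qed
    also have "\<dots> = G t 0" by (simp add: diffquot_def)
    also have "(\<kappa>1 * d powr \<epsilon>) * m = C * (T - t) powr (- ((1 - (\<epsilon> + \<eta>)) / \<beta>))"
    proof -
      have "(T - t) powr (- ((1 - (\<epsilon> + \<eta>)) / \<beta>)) = p powr (\<epsilon> + \<eta> - 1)"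
        by (simp add: p_def s_def powr_powr algebra_simps diff_divide_distrib add_divide_distrib)
      also have "\<dots> = p powr \<epsilon> * p powr \<eta> / p"
        using p(1) by (simp add: powr_diff powr_add)
      finally show ?thesis
        using \<delta> p(1) by (simp add: C_def m_def d_def powr_mult powr_add)
    qed
    finally show "C * (T - t) powr (- ((1 - (\<epsilon> + \<eta>)) / \<beta>)) \<le> G t 0" .
  qed
qed

end

section \<open>Adaptedness, martingale property, oscillation and rate for the version \<phi>\<close>

lemma (in levy) borel_measurable_augmented_filtration_AE:
  fixes g \<phi> :: "'a \<Rightarrow> real"
  assumes "complete_measure M" and t: "t \<le> T" and g: "g \<in> borel_measurable (\<F> t)"
    and eq: "AE \<omega> in M. \<phi> \<omega> = g \<omega>"
  shows "\<phi> \<in> borel_measurable (\<F> t)"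
proof (rule measurableI)
  interpret complete_measure M by fact
  obtain N where N: "{\<omega> \<in> space M. \<not> \<phi> \<omega> = g \<omega>} \<subseteq> N" "N \<in> null_sets M"
    using eq by (rule AE_E3) auto
  fix B :: "real set" assume B: "B \<in> sets borel"
  \<comment> \<open>Completeness makes every subset of \<open>N\<close> a null set, and the
    augmentation places null sets in the filtration at each time.\<close>
  have "\<phi> -` B \<inter> space M \<inter> N \<in> null_sets M" by (rule complete2[OF _ N(2)]) auto
  then have "\<phi> -` B \<inter> space M \<inter> N \<in> sets (\<F> t)" "N \<in> sets (\<F> t)"
    using N(2) null_sets_augmented_filtration[OF t] by auto
  moreover have "g -` B \<inter> space M \<in> sets (\<F> t)" using measurable_sets[OF g B] by simp
  ultimately have "(g -` B \<inter> space M - N) \<union> (\<phi> -` B \<inter> space M \<inter> N) \<in> sets (\<F> t)" by auto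
  also have "(g -` B \<inter> space M - N) \<union> (\<phi> -` B \<inter> space M \<inter> N) = \<phi> -` B \<inter> space M"
    using N(1) by auto
  finally show "\<phi> -` B \<inter> space (\<F> t) \<in> sets (\<F> t)" by simp
qed simp

theorem theorem6:
  fixes M :: "'a measure" and X :: "real \<Rightarrow> 'a \<Rightarrow> real" and \<nu> \<rho> :: "real measure"
    and T \<gamma> \<epsilon> \<beta> \<eta> \<alpha> :: real and f :: "real \<Rightarrow> real" and \<phi> :: "real \<Rightarrow> 'a \<Rightarrow> real"
  assumes "0 < T"
    and "prob_space M" and "complete_measure M"
    and "levy_process M T X"
    and "levy_triplet M T X \<gamma> 0 \<nu>" and "emeasure \<nu> UNIV > 0"
    and "sets M = sets (augmented_filtration M X T)"
    and "prob_space \<rho>" and "sets \<rho> = sets borel" and "emeasure \<rho> {0} = 0"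
    and "0 < \<epsilon>" "\<epsilon> < 1" and "0 < \<beta>" "\<beta> \<le> 2" and "0 < \<eta>" "\<eta> < 1 - \<epsilon>"
    and "\<And>t. t \<in> {0..T} \<Longrightarrow> integrable M (\<lambda>\<omega>. \<bar>X t \<omega>\<bar> powr \<eta>)"
    and "lower_mass \<epsilon> \<rho>"
    and "lower_density M T \<beta> X"
    and "\<alpha> = (1 - (\<epsilon> + \<eta>)) / \<beta>"
    and "\<And>s. s \<in> {0<..T} \<Longrightarrow> TV_rho M \<rho> \<eta> (X s) < \<infinity>"
    and "f \<in> LBV_loc \<eta> \<inter> Hoelder \<eta>"
    and "cadlag_version_upto M T \<phi> (\<lambda>t \<omega>. D_rho \<rho> (F_fun M T X f) t (X t \<omega>))"
  shows "Linf_martingale_upto M (augmented_filtration M X) T \<phi> \<and> maximal_oscillation M T \<phi> \<and>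
    (INF t\<in>{0<..<T}. ennreal ((T - t) powr \<alpha>) * lower_Osc M \<phi> t) > 0"
proof -
  interpret levy M T X
    using assms(1,2,4) by (simp add: levy_def levy_axioms_def)
  obtain H where H: "H > 0" "\<And>x y. \<bar>f x - f y\<bar> \<le> H * \<bar>x - y\<bar> powr \<eta>"
    using assms(22) Hoelder_const by blast
  have f: "mono f" "lower_mass \<eta> (interval_measure f)" using assms(22) by (auto simp: LBV_loc_def)
  have \<eta>_less_1: "\<eta> < 1" using assms(11,16) by simp
  interpret levy_gradient M T X \<rho> f \<eta> H
    by (rule levy_gradient.intro, rule levy_axioms, rule levy_gradient_axioms.intro)
       (fact assms(8) assms(9) assms(15) \<eta>_less_1 H f(1) assms(17) assms(21))+
  obtain r c where rc: "0 < r" "0 < c" and density: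
    "\<And>a b s. - r \<le> a \<Longrightarrow> a < b \<Longrightarrow> b \<le> r \<Longrightarrow> 0 < s \<Longrightarrow> s \<le> T \<Longrightarrow>
      c * (b - a) \<le> prob {\<omega> \<in> space M. s powr (- 1 / \<beta>) * X s \<omega> \<in> {a<..<b}}"
    using lower_densityD[OF assms(19)] by auto
  obtain C where C: "0 < C" "\<And>t. t \<in> {0..<T} \<Longrightarrow> C * (T - t) powr (- \<alpha>) \<le> G t 0"
    using G_0_lower_bound[OF assms(10,13,18) f(2) rc density] unfolding assms(20) by auto
  have scaled: "c * (b - a) * s powr (- 1 / \<beta>) \<le> prob {\<omega> \<in> space M. a < X s \<omega> \<and> X s \<omega> < b}"
    if "0 < s" "s \<le> T" "- r * s powr (1 / \<beta>) \<le> a" "a < b" "b \<le> r * s powr (1 / \<beta>)" for a b s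
    by (rule prob_lower_density[OF density that])
  have inv: "s powr (1 / \<beta>) * s powr (- 1 / \<beta>) = 1" if "0 < s" for s
    using that by (simp flip: powr_add)
  \<comment> \<open>The windows \<open>(0, r * p)\<close> and \<open>(- r * p, 0)\<close> with
    \<open>p = s powr (1 / \<beta>)\<close> carry mass at least
    \<open>c * (r * p) / p = c * r\<close>, whatever \<open>s\<close> is.\<close>
  interpret two_sided_levy M T X "c * r"
  proof unfold_locales
    show "0 < c * r" using rc by simp
    fix s assume s: "s \<in> {0<..T}"
    note [measurable] = X_measurable[of s]
    have sT: "s \<in> {0..T}" using s by auto
    define p where "p = s powr (1 / \<beta>)"
    have p: "0 < p" "p * s powr (- 1 / \<beta>) = 1" using s inv[of s] by (auto simp: p_def)
    have "c * (r * p - 0) * s powr (- 1 / \<beta>) \<le> prob {\<omega> \<in> space M. 0 < X s \<omega> \<and> X s \<omega> < r * p}"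
      using s rc p(1) by (intro scaled) (auto simp: p_def)
    also have "\<dots> \<le> prob {\<omega> \<in> space M. X s \<omega> > 0}" using sT by (intro finite_measure_mono) auto
    finally show "c * r \<le> prob {\<omega> \<in> space M. X s \<omega> > 0}" using p(2) by (simp add: mult.assoc)
    have "c * (0 - - r * p) * s powr (- 1 / \<beta>) \<le> prob {\<omega> \<in> space M. - r * p < X s \<omega> \<and> X s \<omega> < 0}"
      using s rc p(1) by (intro scaled) (auto simp: p_def)
    also have "\<dots> \<le> prob {\<omega> \<in> space M. X s \<omega> < 0}" using sT by (intro finite_measure_mono) auto
    finally show "c * r \<le> prob {\<omega> \<in> space M. X s \<omega> < 0}" using p(2) by (simp add: mult.assoc)
    fix e :: real assume e: "0 < e"
    \<comment> \<open>The minimum keeps the interval inside the density window.\<close>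
    define b where "b = min e (r * p)"
    have b: "0 < b" using e rc p(1) by (simp add: b_def)
    have "0 < c * (b - - b) * s powr (- 1 / \<beta>)" using b rc s by simp
    also have "\<dots> \<le> prob {\<omega> \<in> space M. - b < X s \<omega> \<and> X s \<omega> < b}"
      using s b by (intro scaled) (auto simp: b_def p_def)
    also have "\<dots> \<le> prob {\<omega> \<in> space M. \<bar>X s \<omega>\<bar> < e}"
      using sT by (intro finite_measure_mono) (auto simp: b_def)
    finally show "0 < prob {\<omega> \<in> space M. \<bar>X s \<omega>\<bar> < e}" .
  qed
  have version: "AE \<omega> in M. \<phi> t \<omega> = G t (X t \<omega>)" if "t \<in> {0..<T}" for t
    using assms(23) that by (simp add: cadlag_version_upto_def D_rho_eq_diffquot)
  have G_X_adapted: "(\<lambda>\<omega>. G t (X t \<omega>)) \<in> borel_measurable (\<F> t)" if "t \<in> {0..<T}" for t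
    using that by (intro measurable_compose[OF X_measurable_augmented_filtration G_measurable]) auto
  have adapted: "\<phi> t \<in> borel_measurable (\<F> t)" if "t \<in> {0..<T}" for t
    using that by (intro borel_measurable_augmented_filtration_AE[OF assms(3) _ G_X_adapted version]) auto
  have \<phi>_measurable: "\<phi> t \<in> borel_measurable M" if "t \<in> {0..<T}" for t
    using that by (intro measurable_from_subalg[OF subalgebra_augmented_filtration adapted]) auto
  have \<phi>_integrable: "integrable M (\<phi> t)" if t: "t \<in> {0..<T}" for t
    using integrable_G_X[OF t] \<phi>_measurable[OF t] version[OF t]
    by (subst integrable_cong_AE[where g = "\<lambda>\<omega>. G t (X t \<omega>)"]) auto
  have set_integral: "(LINT \<omega>:A|M. \<phi> t \<omega>) = (LINT \<omega>:A|M. G t (X t \<omega>))"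
    if t: "t \<in> {0..<T}" and A: "A \<in> events" for t A
    unfolding set_lebesgue_integral_def
    using \<phi>_measurable[OF t] A version[OF t] integrable_G_X[OF t]
    by (intro integral_cong_AE) (auto elim!: eventually_mono)

  have "martingale_upto M \<F> T \<phi>"
    unfolding martingale_upto_def
  proof (intro conjI ballI allI impI adapted \<phi>_integrable)
    fix s t assume st: "0 \<le> s \<and> s \<le> t \<and> t < T"
    then have s: "s \<in> {0..<T}" and t: "t \<in> {0..<T}" by auto
    interpret finite_measure_subalgebra M "\<F> s"
      by unfold_locales (use subalgebra_augmented_filtration[of s] s in auto)
    show "AE \<omega> in M. real_cond_exp M (\<F> s) (\<phi> t) \<omega> = \<phi> s \<omega>"
    proof (rule real_cond_exp_charact)
      fix A assume A: "A \<in> sets (\<F> s)"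
      then have AM: "A \<in> events" using subalg by (auto simp: subalgebra_def)
      show "(LINT \<omega>:A|M. \<phi> t \<omega>) = (LINT \<omega>:A|M. \<phi> s \<omega>)"
        using set_integral_G_X[of s t A] st A by (cases "s = t") (auto simp: set_integral[OF s AM] set_integral[OF t AM])
    qed (use s t \<phi>_integrable adapted in auto)
  qed
  moreover have "Linf_norm M (\<phi> t) < \<infinity>" if t: "t \<in> {0..<T}" for t
  proof -
    obtain B where "\<And>x. \<bar>G t x\<bar> \<le> B" using G_bounded[OF t] by auto
    then have "Linf_norm M (\<phi> t) \<le> ennreal B"
      unfolding Linf_norm_def using version[OF t] \<phi>_measurable[OF t]
      by (intro esssup_I) (auto elim!: eventually_mono intro!: ennreal_leI)
    then show ?thesis by (simp add: le_less_trans)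
  qed
  ultimately have "Linf_martingale_upto M \<F> T \<phi>" by (simp add: Linf_martingale_upto_def)

  have osc: "G t y \<le> 2 * k"
    if st: "0 \<le> s" "s < t" "t < T" and k: "Linf_norm M (\<lambda>\<omega>. \<phi> t \<omega> - \<phi> s \<omega>) = ennreal k" "0 \<le> k"
    for s t k y
  proof (rule G_le_twice_oscillation[OF st full_support])
    have "AE \<omega> in M. ennreal \<bar>\<phi> t \<omega> - \<phi> s \<omega>\<bar> \<le> ennreal k"
      using esssup_AE[of "\<lambda>\<omega>. ennreal \<bar>\<phi> t \<omega> - \<phi> s \<omega>\<bar>" M] k(1) by (simp add: Linf_norm_def)
    moreover have "AE \<omega> in M. \<phi> t \<omega> = G t (X t \<omega>)" "AE \<omega> in M. \<phi> s \<omega> = G s (X s \<omega>)"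
      using st by (auto intro!: version)
    ultimately show "AE \<omega> in M. \<bar>G t (X t \<omega>) - G s (X s \<omega>)\<bar> \<le> k"
      by eventually_elim (use k(2) in simp)
  qed
  have "maximal_oscillation M T \<phi>"
    unfolding maximal_oscillation_def lower_Osc_def
  proof (intro exI[of _ 2] conjI ballI INF_greatest)
    fix t s assume t: "t \<in> {0<..<T}" and s: "s \<in> {0..<t}"
    show "ennreal (1 / 2) * Linf_norm M (\<lambda>\<omega>. \<phi> t \<omega> - \<phi> 0 \<omega>) \<le> Linf_norm M (\<lambda>\<omega>. \<phi> t \<omega> - \<phi> s \<omega>)"
    proof (cases "Linf_norm M (\<lambda>\<omega>. \<phi> t \<omega> - \<phi> s \<omega>)")
      case (real k)
      have tT: "t \<in> {0..<T}" "0 \<in> {0..<T}" using t by auto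
      have G_le: "G t y \<le> 2 * k" for y using osc[OF _ _ _ real(2,1)] s t by auto
      have X0: "AE \<omega> in M. X 0 \<omega> = 0" using X_0 by auto
      \<comment> \<open>As the mean of \<open>G t (X t)\<close>, the value \<open>G 0 0\<close> lies
        in the same interval from 0 to \<open>2 * k\<close> as \<open>G t\<close>. Their difference
        is therefore at most \<open>2 * k\<close> and not \<open>4 * k\<close>.\<close>
      have "G 0 0 = expectation (\<lambda>\<omega>. G t (X t \<omega>))"
        using G_shift[of 0 t 0] t X_measurable[of t] G_measurable[OF tT(1)] by (simp add: integral_distr)
      also have "\<dots> \<le> 2 * k"
        using integrable_G_X[OF tT(1)] G_le by (intro integral_le_const AE_I2)
      finally have G0: "G 0 0 \<le> 2 * k" .
      have "Linf_norm M (\<lambda>\<omega>. \<phi> t \<omega> - \<phi> 0 \<omega>) \<le> ennreal (2 * k)"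
        unfolding Linf_norm_def
      proof (rule esssup_I)
        show "(\<lambda>\<omega>. ennreal \<bar>\<phi> t \<omega> - \<phi> 0 \<omega>\<bar>) \<in> borel_measurable M"
          using \<phi>_measurable[OF tT(1)] \<phi>_measurable[OF tT(2)] by measurable
        show "AE \<omega> in M. ennreal \<bar>\<phi> t \<omega> - \<phi> 0 \<omega>\<bar> \<le> ennreal (2 * k)"
          using version[OF tT(1)] version[OF tT(2)] X0
        proof eventually_elim
          case (elim \<omega>)
          then show ?case
            using G_le[of "X t \<omega>"] G0 G_nonneg[OF tT(1), of "X t \<omega>"] G_nonneg[OF tT(2), of 0]
            by (intro ennreal_leI) (simp add: abs_le_iff)
        qed
      qed
      then have "ennreal (1 / 2) * Linf_norm M (\<lambda>\<omega>. \<phi> t \<omega> - \<phi> 0 \<omega>) \<le> ennreal (1 / 2) * ennreal (2 * k)"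
        by (rule mult_left_mono) simp
      also have "\<dots> = ennreal k" using real by (subst ennreal_mult[symmetric]) auto
      finally show ?thesis using real by simp
    qed simp
  qed simp
  moreover have "(INF t\<in>{0<..<T}. ennreal ((T - t) powr \<alpha>) * lower_Osc M \<phi> t) > 0"
  proof (rule less_le_trans)
    \<comment> \<open>A positive infimum needs one constant for all \<open>t\<close>: it is
      \<open>C / 2\<close>, from
      \<open>C * (T - t) powr (- \<alpha>) \<le> G t 0 \<le> 2 * k\<close>.\<close>
    show "0 < ennreal (C / 2)" using C by simp
    show "ennreal (C / 2) \<le> (INF t\<in>{0<..<T}. ennreal ((T - t) powr \<alpha>) * lower_Osc M \<phi> t)"
    proof (rule INF_greatest)
      fix t assume t: "t \<in> {0<..<T}"
      have "ennreal (C / 2 * (T - t) powr (- \<alpha>)) \<le> lower_Osc M \<phi> t"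
        unfolding lower_Osc_def
      proof (rule INF_greatest)
        fix s assume s: "s \<in> {0..<t}"
        show "ennreal (C / 2 * (T - t) powr (- \<alpha>)) \<le> Linf_norm M (\<lambda>\<omega>. \<phi> t \<omega> - \<phi> s \<omega>)"
        proof (cases "Linf_norm M (\<lambda>\<omega>. \<phi> t \<omega> - \<phi> s \<omega>)")
          case (real k)
          have "C * (T - t) powr (- \<alpha>) \<le> 2 * k"
            using osc[of s t k 0] real C(2)[of t] s t by force
          then show ?thesis using real by (simp add: ennreal_leI)
        qed simp
      qed
      then have "ennreal ((T - t) powr \<alpha>) * ennreal (C / 2 * (T - t) powr (- \<alpha>))
          \<le> ennreal ((T - t) powr \<alpha>) * lower_Osc M \<phi> t"
        by (rule mult_left_mono) simp
      moreover have "ennreal ((T - t) powr \<alpha>) * ennreal (C / 2 * (T - t) powr (- \<alpha>)) = ennreal (C / 2)"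
        using t C(1) by (subst ennreal_mult[symmetric]) (auto simp: powr_minus)
      ultimately show "ennreal (C / 2) \<le> ennreal ((T - t) powr \<alpha>) * lower_Osc M \<phi> t"
        by simp
    qed
  qed
  ultimately show ?thesis using \<open>Linf_martingale_upto M \<F> T \<phi>\<close> by simp
qed

end
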